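(* For every sufficiently small constant $\varepsilon>0$ there exist a constant $\delta=\delta(\varepsilon)>0$, depending only on $\varepsilon$, and a constant $C>0$ such that the following holds: for every sufficiently large prime $p$ and every positive odd integer $n$ with $n \mid p-1$ and $n>p^{\varepsilon}$, one has $k(p,n)\le C\,p^{1-\delta}$.
   Context: Let $p$ be a prime and $n$ a positive odd integer with $n\mid p-1$. Define $k(p,n)$ to be the least positive integer $k$ such that, as $x$ ranges over $\{-k,\dots,-1,1,2,\dots,k\}$, the residues $x^n \bmod p$ include every non-zero $n$-th power residue modulo $p$, i.e. every $m\not\equiv 0 \pmod p$ for which $x^n\equiv m\pmod p$ is solvable. *)

theory Defs
  imports Complex_Main "HOL-Number_Theory.Number_Theory"
begin

definition nonzero_power_residue :: "nat \<Rightarrow> nat \<Rightarrow> int \<Rightarrow> bool" where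
  "nonzero_power_residue p n m \<longleftrightarrow>
     \<not> [m = 0] (mod int p) \<and> (\<exists>x::int. [x ^ n = m] (mod int p))"

definition covers_power_residues :: "nat \<Rightarrow> nat \<Rightarrow> nat \<Rightarrow> bool" where
  "covers_power_residues p n k \<longleftrightarrow>
     (\<forall>m. nonzero_power_residue p n m \<longrightarrow>
        (\<exists>x \<in> {- int k..-1} \<union> {1..int k}. [x ^ n = m] (mod int p)))"

definition least_cover :: "nat \<Rightarrow> nat \<Rightarrow> nat" where
  "least_cover p n = (LEAST k. 0 < k \<and> covers_power_residues p n k)"

text \<open>The minimum defining \<^const>\<open>least_cover\<close> is taken over a nonempty set.\<close>

lemma covers_power_residues_self:
  assumes "prime p" and "0 < n"
  shows "0 < p \<and> covers_power_residues p n p"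
  unfolding covers_power_residues_def
proof (intro conjI allI impI)
  show p: "0 < p" using assms(1) by (rule prime_gt_0_nat)
  fix m assume "nonzero_power_residue p n m"
  then obtain x :: int where m: "\<not> [m = 0] (mod int p)" and x: "[x ^ n = m] (mod int p)"
    unfolding nonzero_power_residue_def by blast
  have c: "[(x mod int p) ^ n = m] (mod int p)"
    using x by (simp add: cong_def power_mod)
  have "x mod int p \<noteq> 0"
  proof
    assume "x mod int p = 0"
    with c assms(2) have "[m = 0] (mod int p)" by (simp add: cong_sym_eq zero_power)
    with m show False by contradiction
  qed
  moreover have "0 \<le> x mod int p" "x mod int p < int p" using p by simp_all
  ultimately have "x mod int p \<in> {- int p..-1} \<union> {1..int p}" by simp
  with c show "\<exists>x \<in> {- int p..-1} \<union> {1..int p}. [x ^ n = m] (mod int p)" by blast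
qed

end

theory Submission
  imports Defs "HOL-Library.Set_Algebras" "HOL-Analysis.Convex"
begin

text \<open>
  Let \<open>H\<close> be the group of \<open>n\<close>-th roots of unity modulo \<open>p\<close>. The interval \<open>[-k, k]\<close> fails to represent
  all \<open>n\<close>-th power residues iff it misses a coset \<open>aH\<close>. By Fourier inversion, some nontrivial exponential sum
  over \<open>H\<close> is then at least \<open>n k / (2 p)\<close>, so it suffices to save a power of \<open>p\<close> over the trivial bound \<open>n\<close>,
  following Bourgain, Glibichuk and Konyagin.

  Suppose that such a sum is large. The frequencies at which the sum is at least \<open>t n\<close> form an \<open>H\<close>-invariant set,
  and a proportion \<open>t\<^sup>2/2\<close> of the differences of this set lies in the set belonging to \<open>t\<^sup>2/2\<close>. Iterating
  \<open>t \<mapsto> t\<^sup>2/2\<close>, one finds a scale at which the set hardly grows. The Balog-Szemeredi-Gowers theorem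
  extracts from it a set of small doubling, hence an approximate group \<open>V\<close>, and the invariance yields
  many \<open>h \<in> H\<close> for which \<open>h V\<close> is covered by few translates of \<open>V\<close>. The set of all such
  multipliers is closed under the field operations up to a power of the covering number, and boundedly many
  field operations generate the whole prime field from any set of size \<open>p\<^bsup>c\<^esup>\<close>. So every element of
  the field is such a multiplier, which is impossible unless \<open>V\<close> is very small or nearly the whole field,
  and these are excluded by the \<open>H\<close>-invariance and by Parseval's identity.
\<close>

section \<open>Covering and the Balog-Szemeredi-Gowers theorem\<close>

lemma card_times_fibre_le:
  fixes L :: real
  assumes "finite X" and "\<And>d. d \<in> D \<Longrightarrow> L \<le> real (card {x \<in> X. f x = d})" and "finite D"
  shows "real (card D) * L \<le> real (card X)"
proof -
  have "real (card D) * L \<le> (\<Sum>d\<in>D. real (card {x \<in> X. f x = d}))"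
    using sum_mono[of D "\<lambda>_. L"] assms(2) by simp
  also have "\<dots> = real (card (\<Union>d\<in>D. {x \<in> X. f x = d}))"
    using assms(1,3) by (subst card_UN_disjoint) auto
  also have "\<dots> \<le> real (card X)"
    using assms(1) by (intro of_nat_mono card_mono) auto
  finally show ?thesis .
qed

lemma card_set_plus_le:
  fixes X Y :: "'a::ab_group_add set"
  assumes "finite X" "finite Y"
  shows "card (X + Y) \<le> card X * card Y"
proof -
  have "X + Y = (\<lambda>(x,y). x + y) ` (X \<times> Y)" by (auto simp: set_plus_def)
  then show ?thesis
    using card_image_le[of "X \<times> Y" "\<lambda>(x,y). x + y"] assms by (simp add: card_cartesian_product)
qed

lemma card_le_card_set_plus:
  fixes X Y :: "'a::ab_group_add set"
  assumes "finite X" "finite Y" "y \<in> Y"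
  shows "card X \<le> card (X + Y)"
proof -
  have "card X = card ((\<lambda>x. x + y) ` X)" by (simp add: card_image)
  also have "\<dots> \<le> card (X + Y)"
    using assms by (intro card_mono finite_set_plus) auto
  finally show ?thesis .
qed

text \<open>Take \<open>T\<close> of maximal size among the subsets of \<open>X\<close> whose
  translates t + Y are pairwise disjoint; disjointness is encoded as
  \<open>card (T + Y) = card T * card Y\<close>. By maximality x + Y meets some t + Y for every x in
  \<open>X\<close>, so x lies in t + (Y - Y).\<close>

lemma ruzsa_covering:
  fixes X Y :: "'a::ab_group_add set"
  assumes "finite X" "finite Y" "Y \<noteq> {}"
  shows "\<exists>T. finite T \<and> card T * card Y \<le> card (X + Y) \<and> X \<subseteq> T + (Y + uminus ` Y)"
proof -
  define \<T> where "\<T> = {T. T \<subseteq> X \<and> card (T + Y) = card T * card Y}"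
  have fin: "finite \<T>" unfolding \<T>_def using assms(1) by simp
  have "{} \<in> \<T>" by (simp add: \<T>_def set_plus_def)
  then have "Max (card ` \<T>) \<in> card ` \<T>" using fin by (intro Max_in) auto
  then obtain T where T: "T \<in> \<T>" and "card T = Max (card ` \<T>)" by auto
  then have max: "card T' \<le> card T" if "T' \<in> \<T>" for T' using fin that by simp
  have TX: "T \<subseteq> X" and cT: "card (T + Y) = card T * card Y" using T by (auto simp: \<T>_def)
  have fT: "finite T" using TX assms(1) finite_subset by blast
  have "card T * card Y \<le> card (X + Y)"
    unfolding cT[symmetric] using assms TX by (intro card_mono finite_set_plus set_plus_mono2) auto
  moreover have "x \<in> T + (Y + uminus ` Y)" if "x \<in> X" for x
  proof (cases "x \<in> T")
    case True
    obtain y where "y \<in> Y" using assms by auto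
    then have "x + (y + - y) \<in> T + (Y + uminus ` Y)" using True by (intro set_plus_intro) auto
    then show ?thesis by simp
  next
    case False
    have eq: "insert x T + Y = ((+) x ` Y) \<union> (T + Y)" by (auto simp: set_plus_def)
    have "((+) x ` Y) \<inter> (T + Y) \<noteq> {}"
    proof
      assume dis: "((+) x ` Y) \<inter> (T + Y) = {}"
      have "card (insert x T + Y) = card Y + card T * card Y"
        unfolding eq using dis assms fT cT by (subst card_Un_disjoint) (auto simp: card_image finite_set_plus)
      then have "insert x T \<in> \<T>" using False fT TX that by (simp add: \<T>_def)
      from max[OF this] show False using False fT by simp
    qed
    then obtain y t y' where "y \<in> Y" "t \<in> T" "y' \<in> Y" "x + y = t + y'"
      by (auto simp: set_plus_def)
    then have "x = t + (y' + - y)" by (simp add: algebra_simps)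
    then show ?thesis using \<open>y \<in> Y\<close> \<open>t \<in> T\<close> \<open>y' \<in> Y\<close>
      by (auto intro!: set_plus_intro simp del: add_uminus_conv_diff)
  qed
  ultimately show ?thesis using fT by blast
qed

section \<open>Dependent random choice and the Balog-Szemeredi-Gowers theorem\<close>

text \<open>\<open>U\<close> is the neighbourhood of one well chosen vertex b. A pair with few
  common neighbours lies in few neighbourhoods, so averaging |Nb b|^2 - 8 |bad (Nb b)| over b finds
  a neighbourhood that is large and contains few bad pairs.\<close>

lemma dense_graph_common_neighbours:
  fixes E :: "('a \<times> 'a) set" and \<alpha> :: real
  assumes A: "finite A" "A \<noteq> {}" and E: "E \<subseteq> A \<times> A" and \<alpha>: "0 \<le> \<alpha>"
    and dens: "\<alpha> * real (card A) ^ 2 \<le> real (card E)"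
  defines "codeg \<equiv> \<lambda>a u. real (card {b \<in> A. (a,b) \<in> E \<and> (u,b) \<in> E})"
  shows "\<exists>U \<subseteq> A. \<alpha> / 2 * real (card A) \<le> real (card U) \<and>
    8 * real (card {z \<in> U \<times> U. codeg (fst z) (snd z) < \<alpha>^2/16 * real (card A)}) \<le> real (card U) ^ 2"
proof -
  define N where "N = real (card A)"
  define Nb where "Nb b = {a \<in> A. (a,b) \<in> E}" for b
  define bad where "bad U = {z \<in> U \<times> U. codeg (fst z) (snd z) < \<alpha>^2/16 * N}" for U
  have Npos: "N > 0" using A by (simp add: N_def card_gt_0_iff)
  have finNb: "finite (Nb b)" for b using A by (simp add: Nb_def)
  have "card E = (\<Sum>b\<in>A. card (Nb b))"
  proof -
    have "E = (\<Union>b\<in>A. (\<lambda>a. (a,b)) ` Nb b)" using E by (auto simp: Nb_def)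
    then have "card E = card (\<Union>b\<in>A. (\<lambda>a. (a,b)) ` Nb b)" by simp
    also have "\<dots> = (\<Sum>b\<in>A. card ((\<lambda>a. (a,b)) ` Nb b))"
      using A finNb by (intro card_UN_disjoint) auto
    finally show ?thesis by (simp add: card_image inj_on_def)
  qed
  then have sumE: "\<alpha> * N^2 \<le> (\<Sum>b\<in>A. real (card (Nb b)))"
    using dens by (simp add: N_def)
  have sq: "\<alpha>^2 * N^3 \<le> (\<Sum>b\<in>A. real (card (Nb b)) ^ 2)"
  proof -
    have "(\<alpha> * N^2)^2 \<le> (\<Sum>b\<in>A. real (card (Nb b)))^2"
      using sumE \<alpha> by (intro power_mono) auto
    also have "\<dots> \<le> (\<Sum>b\<in>A. real (card (Nb b)) ^ 2) * N"
      using sum_squared_le_sum_of_squares[of "\<lambda>b. real (card (Nb b))" A] A by (simp add: N_def mult.commute)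
    finally have "(\<alpha>^2 * N^3) * N \<le> (\<Sum>b\<in>A. real (card (Nb b)) ^ 2) * N"
      by (simp add: power2_eq_square power3_eq_cube algebra_simps)
    then show ?thesis using Npos by simp
  qed
  have badsum: "(\<Sum>b\<in>A. real (card (bad (Nb b)))) \<le> \<alpha>^2/16 * N^3"
  proof -
    have "(\<Sum>b\<in>A. card (bad (Nb b))) = (\<Sum>b\<in>A. card {z \<in> bad A. (fst z, b) \<in> E \<and> (snd z, b) \<in> E})"
      by (intro sum.cong refl arg_cong[where f=card]) (auto simp: bad_def Nb_def)
    also have "\<dots> = (\<Sum>z\<in>bad A. card {b \<in> A. (fst z, b) \<in> E \<and> (snd z, b) \<in> E})"
      by (rule sum_multicount_gen) (use A in \<open>auto simp: bad_def\<close>)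
    finally have "(\<Sum>b\<in>A. real (card (bad (Nb b)))) = (\<Sum>z\<in>bad A. codeg (fst z) (snd z))"
      unfolding codeg_def by (metis (no_types, lifting) of_nat_sum sum.cong)
    also have "\<dots> \<le> (\<Sum>z\<in>bad A. \<alpha>^2/16 * N)"
      by (intro sum_mono) (auto simp: bad_def)
    also have "\<dots> = real (card (bad A)) * (\<alpha>^2/16 * N)" by simp
    also have "\<dots> \<le> N^2 * (\<alpha>^2/16 * N)"
    proof (intro mult_right_mono)
      have "card (bad A) \<le> card (A \<times> A)" using A by (intro card_mono) (auto simp: bad_def)
      then show "real (card (bad A)) \<le> N^2"
        unfolding N_def power2_eq_square card_cartesian_product by (metis of_nat_le_iff of_nat_mult)
    qed (use Npos in auto)
    finally show ?thesis by (simp add: power2_eq_square power3_eq_cube algebra_simps)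
  qed
  \<comment> \<open>With the codegree threshold \<alpha>^2/16, eight times the bad pairs use up at
    most half of the sum of squares.\<close>
  have "\<exists>b\<in>A. \<alpha>^2 * N^2 / 2 \<le> real (card (Nb b)) ^ 2 - 8 * real (card (bad (Nb b)))"
  proof (rule ccontr)
    assume "\<not> ?thesis"
    then have "(\<Sum>b\<in>A. real (card (Nb b)) ^ 2 - 8 * real (card (bad (Nb b)))) < (\<Sum>b\<in>A. \<alpha>^2 * N^2 / 2)"
      using A by (intro sum_strict_mono) auto
    also have "\<dots> = \<alpha>^2 * N^3 / 2" by (simp add: N_def power2_eq_square power3_eq_cube)
    finally show False using sq badsum by (simp add: sum_subtractf sum_distrib_left[symmetric])
  qed
  then obtain b where b: "b \<in> A" "\<alpha>^2 * N^2 / 2 \<le> real (card (Nb b)) ^ 2 - 8 * real (card (bad (Nb b)))"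
    by blast
  have "(\<alpha> / 2 * N)^2 \<le> real (card (Nb b)) ^ 2"
    using b by (simp add: power_mult_distrib power_divide) (smt (verit) mult_nonneg_nonneg of_nat_0_le_iff zero_le_power2)
  then have "\<alpha> / 2 * N \<le> real (card (Nb b))" by (rule power2_le_imp_le) simp
  moreover have "8 * real (card (bad (Nb b))) \<le> real (card (Nb b)) ^ 2"
    using b(2) by (smt (verit) mult_nonneg_nonneg divide_nonneg_nonneg zero_le_power2)
  moreover have "Nb b \<subseteq> A" by (auto simp: Nb_def)
  ultimately show ?thesis unfolding bad_def N_def by blast
qed

text \<open>Markov's inequality: there are at most |U|^2/8 bad pairs, so at most half of
  \<open>U\<close> has more than |U|/4 bad partners. These vertices are discarded, and any two
  survivors together exclude at most half of \<open>U\<close>.\<close>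

lemma prune_bad_pairs:
  fixes Bad :: "'a \<Rightarrow> 'a \<Rightarrow> bool"
  assumes U: "finite U" and few: "8 * real (card {z \<in> U \<times> U. Bad (fst z) (snd z)}) \<le> real (card U) ^ 2"
  shows "\<exists>A' \<subseteq> U. real (card U) / 2 \<le> real (card A') \<and>
    (\<forall>a\<in>A'. \<forall>a'\<in>A'. real (card U) / 2 \<le> real (card {u \<in> U. \<not> Bad a u \<and> \<not> Bad a' u}))"
proof -
  define A' where "A' = {a \<in> U. 4 * card {u \<in> U. Bad a u} \<le> card U}"
  have half: "real (card U) / 2 \<le> real (card A')"
  proof (cases "U = {}")
    case False
    then have pos: "real (card U) > 0" using U by (simp add: card_gt_0_iff)
    have "{z \<in> U \<times> U. Bad (fst z) (snd z)} = Sigma U (\<lambda>a. {u \<in> U. Bad a u})" by auto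
    then have eq: "real (card {z \<in> U \<times> U. Bad (fst z) (snd z)}) = (\<Sum>a\<in>U. real (card {u \<in> U. Bad a u}))"
      using U by (simp add: card_SigmaI)
    have "real (card (U - A')) * (real (card U) / 4) = (\<Sum>a\<in>U - A'. real (card U) / 4)" by simp
    also have "\<dots> \<le> (\<Sum>a\<in>U - A'. real (card {u \<in> U. Bad a u}))"
      by (intro sum_mono) (auto simp: A'_def)
    also have "\<dots> \<le> (\<Sum>a\<in>U. real (card {u \<in> U. Bad a u}))"
      using U by (intro sum_mono2) auto
    finally have "real (card (U - A')) * (real (card U) / 4) \<le> real (card U) ^ 2 / 8"
      using few unfolding eq by linarith
    then have "real (card U) * (2 * real (card (U - A'))) \<le> real (card U) * real (card U)"
      by (simp add: power2_eq_square algebra_simps)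
    then have "2 * real (card (U - A')) \<le> real (card U)" using pos by simp
    moreover have "card (U - A') = card U - card A'" "card A' \<le> card U"
      using U by (auto intro!: card_Diff_subset card_mono simp: A'_def)
    ultimately show ?thesis by (simp add: of_nat_diff)
  qed simp
  have "real (card U) / 2 \<le> real (card {u \<in> U. \<not> Bad a u \<and> \<not> Bad a' u})"
    if "a \<in> A'" "a' \<in> A'" for a a'
  proof -
    have "U = {u \<in> U. \<not> Bad a u \<and> \<not> Bad a' u} \<union> ({u \<in> U. Bad a u} \<union> {u \<in> U. Bad a' u})" by auto
    then have "card U \<le> card {u \<in> U. \<not> Bad a u \<and> \<not> Bad a' u} + card ({u \<in> U. Bad a u} \<union> {u \<in> U. Bad a' u})"
      by (metis (no_types, lifting) card_Un_le)
    also have "card ({u \<in> U. Bad a u} \<union> {u \<in> U. Bad a' u}) \<le> card {u \<in> U. Bad a u} + card {u \<in> U. Bad a' u}"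
      by (rule card_Un_le)
    finally show ?thesis using that by (simp add: A'_def)
  qed
  moreover have "A' \<subseteq> U" by (auto simp: A'_def)
  ultimately show ?thesis using half by blast
qed

text \<open>After pruning, any two remaining vertices are joined by at least \<open>L\<close> walks
  of length four, and \<open>L\<close> is at least \<alpha>^5 |A|^3 / 1024. Comparing with the |C|^4
  available quadruples of edge differences gives the exponents and the constant.\<close>

theorem balog_szemeredi_gowers:
  fixes A C :: "'a::ab_group_add set" and E :: "('a \<times> 'a) set" and \<alpha> \<kappa> :: real
  assumes A: "finite A" "A \<noteq> {}" and C: "finite C" and E: "E \<subseteq> A \<times> A" and \<alpha>: "0 < \<alpha>"
    and dens: "\<alpha> * real (card A) ^ 2 \<le> real (card E)"
    and diff: "\<And>a b. (a,b) \<in> E \<Longrightarrow> a - b \<in> C"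
    and Cle: "real (card C) \<le> \<kappa> * real (card A)"
  shows "\<exists>A' \<subseteq> A. \<alpha> / 4 * real (card A) \<le> real (card A') \<and>
     real (card (A' + uminus ` A')) * \<alpha>^5 \<le> 1024 * \<kappa>^4 * real (card A)"
proof -
  define N where "N = real (card A)"
  define \<eta> where "\<eta> = \<alpha>^2/16 * N"
  define com where "com a u = {b \<in> A. (a,b) \<in> E \<and> (u,b) \<in> E}" for a u
  have Npos: "N > 0" using A by (simp add: N_def card_gt_0_iff)
  have \<eta>: "\<eta> > 0" using Npos \<alpha> by (simp add: \<eta>_def)
  obtain U where U: "U \<subseteq> A" "\<alpha> / 2 * N \<le> real (card U)"
    "8 * real (card {z \<in> U \<times> U. real (card (com (fst z) (snd z))) < \<eta>}) \<le> real (card U) ^ 2"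
    using dense_graph_common_neighbours[OF A E less_imp_le[OF \<alpha>] dens]
    unfolding com_def \<eta>_def N_def by blast
  have fU: "finite U" using U A finite_subset by blast
  obtain A' where A': "A' \<subseteq> U" "real (card U) / 2 \<le> real (card A')"
    and mid: "\<And>a a'. a \<in> A' \<Longrightarrow> a' \<in> A' \<Longrightarrow>
      real (card U) / 2 \<le> real (card {u \<in> U. \<not> real (card (com a u)) < \<eta> \<and> \<not> real (card (com a' u)) < \<eta>})"
    using prune_bad_pairs[OF fU, of "\<lambda>a u. real (card (com a u)) < \<eta>"] U(3) by blast
  have fA': "finite A'" using A' fU finite_subset by blast
  define L where "L = real (card U) / 2 * \<eta>^2"
  \<comment> \<open>Each \<open>a - a'\<close> is an alternating sum of four elements of \<open>C\<close> in at least \<open>L\<close> ways: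
    walk from \<open>a\<close> to \<open>a'\<close> along \<open>a, b1, u, b2, a'\<close> in the graph.\<close>
  define f :: "'a \<times> 'a \<times> 'a \<times> 'a \<Rightarrow> 'a" where "f = (\<lambda>(c1,c2,c3,c4). c1 - c2 + c3 - c4)"
  have fib: "L \<le> real (card {x \<in> C \<times> C \<times> C \<times> C. f x = d})" if d: "d \<in> A' + uminus ` A'" for d
  proof -
    obtain a a' where a: "a \<in> A'" "a' \<in> A'" "d = a - a'" using d by (auto simp: set_plus_def)
    define G where "G = {u \<in> U. \<not> real (card (com a u)) < \<eta> \<and> \<not> real (card (com a' u)) < \<eta>}"
    define P where "P = Sigma G (\<lambda>u. com a u \<times> com a' u)"
    define g where "g = (\<lambda>(u, b1, b2). (a - b1, u - b1, u - b2, a' - b2))"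
    have fG: "finite G" using fU by (simp add: G_def)
    have fcom: "finite (com x y)" for x y using A by (simp add: com_def)
    have "L \<le> real (card G) * \<eta>^2"
      unfolding L_def using mid[OF a(1,2)] by (intro mult_right_mono) (auto simp: G_def)
    also have "\<dots> = (\<Sum>u\<in>G. \<eta>^2)" by simp
    also have "\<dots> \<le> (\<Sum>u\<in>G. real (card (com a u \<times> com a' u)))"
      unfolding card_cartesian_product of_nat_mult power2_eq_square
      by (intro sum_mono mult_mono) (use \<eta> in \<open>auto simp: G_def\<close>)
    also have "\<dots> = real (card P)"
      unfolding P_def using fG fcom by (subst card_SigmaI) auto
    also have "\<dots> = real (card (g ` P))"
      by (subst card_image) (auto simp: g_def inj_on_def)
    also have "\<dots> \<le> real (card {x \<in> C \<times> C \<times> C \<times> C. f x = d})"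
      using C by (intro of_nat_mono card_mono)
        (auto simp: g_def P_def G_def com_def f_def a intro: diff)
    finally show ?thesis .
  qed
  have "real (card (A' + uminus ` A')) * L \<le> real (card (C \<times> C \<times> C \<times> C))"
    using fA' C by (intro card_times_fibre_le[where f=f] fib) (auto intro: finite_set_plus)
  also have "\<dots> = real (card C) ^ 4" by (simp add: card_cartesian_product power4_eq_xxxx)
  also have "\<dots> \<le> (\<kappa> * N)^4" using Cle by (intro power_mono) (auto simp: N_def)
  finally have 1: "real (card (A' + uminus ` A')) * L \<le> \<kappa>^4 * N^4" by (simp add: power_mult_distrib)
  have "\<alpha> / 4 * N * \<eta>^2 \<le> L" unfolding L_def using U(2) by (intro mult_right_mono) (auto simp: mult.commute)
  then have "real (card (A' + uminus ` A')) * (\<alpha> / 4 * N * \<eta>^2) \<le> \<kappa>^4 * N^4"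
    using 1 by (meson mult_left_mono of_nat_0_le_iff order_trans)
  then have "(real (card (A' + uminus ` A')) * \<alpha>^5) * N^3 \<le> (1024 * \<kappa>^4 * N) * N^3"
    by (simp add: \<eta>_def power_mult_distrib power_divide power2_eq_square power3_eq_cube
        power4_eq_xxxx eval_nat_numeral algebra_simps)
  then have "real (card (A' + uminus ` A')) * \<alpha>^5 \<le> 1024 * \<kappa>^4 * N"
    using Npos by simp
  moreover have "\<alpha> / 4 * N \<le> real (card A')" using A' U(2) by simp
  ultimately show ?thesis using A'(1) U(1) unfolding N_def by blast
qed

section \<open>Popular differences\<close>

text \<open>The cardinality counts the representations of d as a difference of two elements of
  \<open>A\<close>, since d = (b + d) - b.\<close>

definition popular_diffs :: "real \<Rightarrow> 'a::ab_group_add set \<Rightarrow> 'a set" where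
  "popular_diffs c A = {d. c \<le> real (card {b \<in> A. b + d \<in> A})}"

lemma popular_diffs_subset:
  assumes "0 < c" shows "popular_diffs c A \<subseteq> A + uminus ` A"
proof
  fix d assume "d \<in> popular_diffs c A"
  then have "0 < real (card {b \<in> A. b + d \<in> A})" using assms by (simp add: popular_diffs_def)
  then have "{b \<in> A. b + d \<in> A} \<noteq> {}" by force
  then obtain b where "b \<in> A" "b + d \<in> A" by blast
  then have "(b + d) + - b \<in> A + uminus ` A" by blast
  then show "d \<in> A + uminus ` A" by simp
qed

lemma finite_popular_diffs: "finite A \<Longrightarrow> 0 < c \<Longrightarrow> finite (popular_diffs c A)"
  by (meson finite_imageI finite_set_plus finite_subset popular_diffs_subset)

lemma uminus_popular_diffs: "uminus ` popular_diffs c A = popular_diffs c A"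
proof -
  have *: "card {b \<in> A. b + d \<in> A} = card {b \<in> A. b + - d \<in> A}" for d :: 'a
    by (rule bij_betw_same_card[of "\<lambda>b. b + d"], rule bij_betw_byWitness[where f'="\<lambda>b. b - d"]) auto
  have "- d \<in> popular_diffs c A" if "d \<in> popular_diffs c A" for d
    using that *[of d] by (simp add: popular_diffs_def)
  then show ?thesis by (force simp: image_iff intro: bexI[of _ "- _"])
qed

text \<open>
  Iterating this with \<open>X = A\<close> bounds all sums \<open>S + \<dots> + S\<close> of popular differences, in place of
  Pluennecke's inequality for \<open>A\<close> itself.
\<close>

lemma card_plus_popular_diffs_plus:
  fixes X Y :: "'a::ab_group_add set"
  assumes A: "finite A" and c: "0 < c" and X: "finite X" and Y: "finite Y"
  shows "real (card (X + (popular_diffs c A + Y))) * c \<le> real (card (X + uminus ` A)) * real (card (A + Y))"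
proof -
  have "real (card (X + (popular_diffs c A + Y))) * c \<le> real (card ((X + uminus ` A) \<times> (A + Y)))"
  proof (rule card_times_fibre_le[where f="\<lambda>(u,v). u + v"])
    fix d assume "d \<in> X + (popular_diffs c A + Y)"
    then obtain x s y where d: "d = x + (s + y)" "x \<in> X" "s \<in> popular_diffs c A" "y \<in> Y"
      by (auto simp: set_plus_def)
    have "c \<le> real (card {b \<in> A. b + s \<in> A})" using d by (simp add: popular_diffs_def)
    \<comment> \<open>Every such b gives the decomposition d = (x - b) + ((b + s) + y), and distinct
      b give distinct ones.\<close>
    also have "\<dots> = real (card ((\<lambda>b. (x + - b, (b + s) + y)) ` {b \<in> A. b + s \<in> A}))"
      by (subst card_image) (auto simp: inj_on_def)
    also have "\<dots> \<le> real (card {z \<in> (X + uminus ` A) \<times> (A + Y). (case z of (u,v) \<Rightarrow> u + v) = d})"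
    proof (intro of_nat_mono card_mono)
      show "finite {z \<in> (X + uminus ` A) \<times> (A + Y). (case z of (u,v) \<Rightarrow> u + v) = d}"
        by (rule finite_subset[of _ "(X + uminus ` A) \<times> (A + Y)"]) (use A X Y in \<open>auto intro!: finite_set_plus\<close>)
    qed (use d in \<open>auto intro!: set_plus_intro simp del: add_uminus_conv_diff\<close>)
    finally show "c \<le> real (card {z \<in> (X + uminus ` A) \<times> (A + Y). (case z of (u,v) \<Rightarrow> u + v) = d})" .
  qed (use assms in \<open>auto intro!: finite_set_plus finite_popular_diffs\<close>)
  then show ?thesis by (simp add: card_cartesian_product)
qed

text \<open>The representation counts add up to |Z|^2 over \<open>D\<close>. Those below
  \<open>c\<close> contribute at most c |D|, which is at most half of the total, and each of the
  others is at most |Z|. Since \<open>D\<close> may exceed Z - Z, one bound on |D| serves all dense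
  subsets of a fixed set.\<close>

lemma card_popular_diffs_Int_ge:
  fixes Z :: "'a::ab_group_add set"
  assumes Z: "finite Z" "Z \<noteq> {}" and D: "finite D" "Z + uminus ` Z \<subseteq> D" and c: "0 \<le> c"
    and small: "2 * c * real (card D) \<le> real (card Z) ^ 2"
  shows "real (card Z) \<le> 2 * real (card (popular_diffs c Z \<inter> D))"
proof -
  define r where "r d = real (card {b \<in> Z. b + d \<in> Z})" for d
  define S where "S = popular_diffs c Z \<inter> D"
  have Zp: "real (card Z) > 0" using Z by (simp add: card_gt_0_iff)
  have "card {b \<in> Z. b + d \<in> Z} = card {x \<in> Z \<times> Z. fst x - snd x = d}" for d
    by (rule bij_betw_same_card[of "\<lambda>b. (b + d, b)"], rule bij_betw_byWitness[where f'="snd"])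
      (auto simp: algebra_simps)
  then have "(\<Sum>d\<in>D. r d) = (\<Sum>d\<in>D. real (card {x \<in> Z \<times> Z. fst x - snd x = d}))"
    by (simp add: r_def)
  also have "\<dots> = real (card (\<Union>d\<in>D. {x \<in> Z \<times> Z. fst x - snd x = d}))"
    using D Z by (subst card_UN_disjoint) auto
  also have "(\<Union>d\<in>D. {x \<in> Z \<times> Z. fst x - snd x = d}) = Z \<times> Z"
  proof -
    have "a - b \<in> D" if "a \<in> Z" "b \<in> Z" for a b
      using D(2) set_plus_intro[of a Z "- b" "uminus ` Z"] that by auto
    then show ?thesis by auto
  qed
  finally have tot: "(\<Sum>d\<in>D. r d) = real (card Z)^2"
    by (simp add: card_cartesian_product power2_eq_square)
  have "(\<Sum>d\<in>D. r d) = (\<Sum>d\<in>D - S. r d) + (\<Sum>d\<in>S. r d)"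
    using D by (intro sum.subset_diff) (auto simp: S_def)
  also have "(\<Sum>d\<in>D - S. r d) \<le> (\<Sum>d\<in>D - S. c)"
    by (intro sum_mono) (auto simp: S_def popular_diffs_def r_def)
  also have "(\<Sum>d\<in>D - S. c) \<le> c * real (card D)"
    using D c by (simp add: mult.commute mult_left_mono card_mono)
  also have "(\<Sum>d\<in>S. r d) \<le> (\<Sum>d\<in>S. real (card Z))"
    unfolding r_def using Z by (intro sum_mono of_nat_mono card_mono) auto
  finally have "real (card Z)^2 \<le> c * real (card D) + real (card S) * real (card Z)"
    using tot by simp
  then have "real (card Z) * real (card Z) \<le> (2 * real (card S)) * real (card Z)"
    using small by (simp add: power2_eq_square)
  then show ?thesis using Zp by (simp add: S_def)
qed

section \<open>Multipliers of an approximate group\<close>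

text \<open>A copy of a prime field inside a commutative ring type; its unit \<open>e\<close> need not be the ring's \<open>1\<close>.\<close>

locale prime_field_in_ring =
  fixes F :: "'a::comm_ring_1 set" and e :: 'a
  assumes finF: "finite F"
    and unit_mem: "e \<in> F"
    and unit_neq_0: "e \<noteq> 0"
    and add_mem: "x \<in> F \<Longrightarrow> y \<in> F \<Longrightarrow> x + y \<in> F"
    and uminus_mem: "x \<in> F \<Longrightarrow> - x \<in> F"
    and mult_mem: "x \<in> F \<Longrightarrow> y \<in> F \<Longrightarrow> x * y \<in> F"
    and unit_mult: "x \<in> F \<Longrightarrow> e * x = x"
    and inverse_ex: "x \<in> F \<Longrightarrow> x \<noteq> 0 \<Longrightarrow> \<exists>y\<in>F. x * y = e"
    and unit_generates: "0 \<in> Q \<Longrightarrow> (\<And>x. x \<in> Q \<Longrightarrow> x + e \<in> Q) \<Longrightarrow> F \<subseteq> Q"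
begin

lemma diff_mem: "x \<in> F \<Longrightarrow> y \<in> F \<Longrightarrow> x - y \<in> F"
  using add_mem[of x "- y"] uminus_mem by simp

lemma zero_mem: "0 \<in> F"
  using diff_mem[OF unit_mem unit_mem] by simp

lemma mult_left_cancel_mem:
  assumes "x \<in> F" "x \<noteq> 0" "y \<in> F" "z \<in> F" "x * y = x * z"
  shows "y = z"
proof -
  obtain w where w: "w \<in> F" "x * w = e" using inverse_ex assms by blast
  have "w * (x * y) = w * (x * z)" using assms by simp
  then have "(x * w) * y = (x * w) * z" by (simp add: ac_simps)
  then show ?thesis using w assms unit_mult by simp
qed

lemma mult_eq_0_mem:
  assumes "x \<in> F" "y \<in> F" "x * y = 0"
  shows "x = 0 \<or> y = 0"
  using mult_left_cancel_mem[of x y 0] assms zero_mem by auto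

end

text \<open>A K-approximate group. The doubling condition is phrased by covering rather than by
  cardinality because coverings can be composed.\<close>

locale approx_group_in_field = prime_field_in_ring F e for F :: "'a::comm_ring_1 set" and e +
  fixes V :: "'a set" and K :: real
  assumes VF: "V \<subseteq> F"
    and zeroV: "0 \<in> V"
    and symV: "uminus ` V = V"
    and doubling: "\<exists>T. finite T \<and> real (card T) \<le> K \<and> V + V \<subseteq> T + V"
begin

text \<open>A good multiplier almost preserves \<open>V\<close>. Coverings compose, so the bounds
  \<open>M\<close> only multiply under field operations, up to powers of \<open>K\<close>; the good
  multipliers thus behave almost like a subfield.\<close>

definition good :: "real \<Rightarrow> 'a \<Rightarrow> bool" where
  "good M x \<longleftrightarrow> (\<exists>T. finite T \<and> real (card T) \<le> M \<and> (*) x ` V \<subseteq> T + V)"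

lemma finV: "finite V" using VF finF finite_subset by blast

lemma cardV_pos: "0 < card V" using finV zeroV by (auto simp: card_gt_0_iff)

lemma K_ge_1: "1 \<le> K"
proof -
  obtain T where T: "finite T" "real (card T) \<le> K" "V + V \<subseteq> T + V" using doubling by blast
  have "0 + 0 \<in> V + V" using zeroV by blast
  then have "T \<noteq> {}" using T(3) by (auto simp: set_plus_def)
  then have "1 \<le> card T" using T(1) by (simp add: Suc_le_eq card_gt_0_iff)
  then show ?thesis using T(2) by linarith
qed

lemma good_ge_1: "good M x \<Longrightarrow> 1 \<le> M"
proof -
  assume "good M x"
  then obtain T where T: "finite T" "real (card T) \<le> M" "(*) x ` V \<subseteq> T + V" by (auto simp: good_def)
  then have "T \<noteq> {}" using zeroV by (auto simp: set_plus_def)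
  then have "1 \<le> card T" using T(1) by (simp add: Suc_le_eq card_gt_0_iff)
  then show ?thesis using T(2) by linarith
qed

lemma good_mono: "good M x \<Longrightarrow> M \<le> M' \<Longrightarrow> good M' x"
  unfolding good_def by (meson order_trans)

text \<open>The factor \<open>K\<close> arises because adding translates of \<open>V\<close> gives
  translates of V + V, which have to be covered by translates of \<open>V\<close> again.\<close>

lemma good_add:
  assumes "good M x" "good M' y"
  shows "good (K * M * M') (x + y)"
proof -
  obtain T where T: "finite T" "real (card T) \<le> K" "V + V \<subseteq> T + V" using doubling by blast
  obtain X where X: "finite X" "real (card X) \<le> M" "(*) x ` V \<subseteq> X + V" using assms by (auto simp: good_def)
  obtain Y where Y: "finite Y" "real (card Y) \<le> M'" "(*) y ` V \<subseteq> Y + V" using assms by (auto simp: good_def)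
  have "(*) (x + y) ` V \<subseteq> (*) x ` V + (*) y ` V"
    by (auto simp: distrib_right)
  also have "\<dots> \<subseteq> (X + V) + (Y + V)" using X Y by (intro set_plus_mono2)
  also have "\<dots> = (X + Y) + (V + V)" by (simp add: ac_simps)
  also have "\<dots> \<subseteq> (X + Y) + (T + V)" by (rule set_plus_mono2[OF order_refl T(3)])
  also have "\<dots> = (T + X + Y) + V" by (simp add: ac_simps)
  finally have 1: "(*) (x + y) ` V \<subseteq> (T + X + Y) + V" .
  have "card (T + X + Y) \<le> card T * card X * card Y"
    using card_set_plus_le[of "T + X" Y] card_set_plus_le[of T X] T X Y finite_set_plus[of T X]
    by (meson mult_le_mono1 order_trans)
  then have "real (card (T + X + Y)) \<le> real (card T) * real (card X) * real (card Y)"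
    by (metis of_nat_le_iff of_nat_mult)
  also have "\<dots> \<le> K * M * M'"
    using T X Y good_ge_1[OF assms(1)] K_ge_1 by (intro mult_mono) auto
  finally show ?thesis using 1 T X Y by (auto simp: good_def intro!: exI[of _ "T + X + Y"] finite_set_plus)
qed

lemma good_uminus:
  assumes "good M x" shows "good M (- x)"
proof -
  have "(*) (- x) ` V = (*) x ` uminus ` V" by (auto simp: image_image)
  then show ?thesis using assms symV by (simp add: good_def)
qed

lemma good_diff: "good M x \<Longrightarrow> good M' y \<Longrightarrow> good (K * M * M') (x - y)"
  using good_add[of M x M' "- y"] good_uminus by simp

lemma good_mult:
  assumes "good M x" "good M' y"
  shows "good (M * M') (x * y)"
proof -
  obtain X where X: "finite X" "real (card X) \<le> M" "(*) x ` V \<subseteq> X + V" using assms by (auto simp: good_def)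
  obtain Y where Y: "finite Y" "real (card Y) \<le> M'" "(*) y ` V \<subseteq> Y + V" using assms by (auto simp: good_def)
  have "(*) (x * y) ` V = (*) x ` ((*) y ` V)" by (auto simp: image_image mult.assoc)
  also have "\<dots> \<subseteq> (*) x ` (Y + V)" using Y by blast
  also have "\<dots> \<subseteq> (*) x ` Y + (*) x ` V" by (force simp: set_plus_def distrib_left)
  also have "\<dots> \<subseteq> (*) x ` Y + (X + V)" using X by (intro set_plus_mono2) auto
  also have "\<dots> = (X + (*) x ` Y) + V" by (simp add: ac_simps)
  finally have 1: "(*) (x * y) ` V \<subseteq> (X + (*) x ` Y) + V" .
  have "card (X + (*) x ` Y) \<le> card X * card ((*) x ` Y)" using X Y by (intro card_set_plus_le) auto
  also have "\<dots> \<le> card X * card Y" using Y by (intro mult_left_mono card_image_le) auto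
  finally have "real (card (X + (*) x ` Y)) \<le> real (card X) * real (card Y)"
    by (metis of_nat_le_iff of_nat_mult)
  also have "\<dots> \<le> M * M'"
    using X Y good_ge_1[OF assms(1)] by (intro mult_mono) auto
  finally show ?thesis using 1 X Y by (auto simp: good_def intro!: exI[of _ "X + (*) x ` Y"] finite_set_plus)
qed

text \<open>The set y' V + V lies in the dilate by y' of y V + V, hence is small, and Ruzsa's
  covering lemma covers y' V by translates of V - V = V + V. One factor \<open>K\<close> comes from
  the size estimate, the other from covering V + V.\<close>

lemma good_inverse:
  assumes "good M y" "y * y' = e"
  shows "good (K * K * M) y'"
proof -
  obtain T where T: "finite T" "real (card T) \<le> K" "V + V \<subseteq> T + V" using doubling by blast
  obtain Y where Y: "finite Y" "real (card Y) \<le> M" "(*) y ` V \<subseteq> Y + V" using assms by (auto simp: good_def)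
  have "(*) y ` V + V \<subseteq> (Y + V) + V" using Y by (intro set_plus_mono2) auto
  also have "\<dots> = Y + (V + V)" by (simp add: ac_simps)
  also have "\<dots> \<subseteq> Y + (T + V)" by (rule set_plus_mono2[OF order_refl T(3)])
  also have "\<dots> = (T + Y) + V" by (simp add: ac_simps)
  finally have sub: "(*) y ` V + V \<subseteq> (T + Y) + V" .
  have yy: "y' * (y * v) = v" if "v \<in> V" for v
    using that VF unit_mult[of v] assms(2) by (metis mult.assoc mult.commute subsetD)
  have "(*) y' ` V + V \<subseteq> (*) y' ` ((*) y ` V + V)"
  proof
    fix w assume "w \<in> (*) y' ` V + V"
    then obtain u v where w: "w = y' * u + v" "u \<in> V" "v \<in> V" by (auto simp: set_plus_def)
    then have "w = y' * (y * v + u)" using yy[of v] by (simp add: distrib_left)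
    then show "w \<in> (*) y' ` ((*) y ` V + V)" using w by blast
  qed
  then have "card ((*) y' ` V + V) \<le> card ((*) y ` V + V)"
    using finV by (meson card_image_le card_mono finite_imageI finite_set_plus order_trans)
  also have "\<dots> \<le> card ((T + Y) + V)"
    using finV T Y sub by (intro card_mono finite_set_plus) auto
  also have "\<dots> \<le> card (T + Y) * card V"
    using T Y finV by (intro card_set_plus_le finite_set_plus) auto
  also have "\<dots> \<le> card T * card Y * card V"
    using T Y by (intro mult_right_mono card_set_plus_le) auto
  finally have le: "card ((*) y' ` V + V) \<le> card T * card Y * card V" .
  obtain X where X: "finite X" "card X * card V \<le> card ((*) y' ` V + V)" "(*) y' ` V \<subseteq> X + (V + uminus ` V)"
    using ruzsa_covering[of "(*) y' ` V" V] finV zeroV by auto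
  have "card X * card V \<le> card T * card Y * card V" using X(2) le by (rule order_trans)
  then have "card X \<le> card T * card Y" using cardV_pos by simp
  then have cX: "real (card X) \<le> real (card T) * real (card Y)"
    by (metis of_nat_le_iff of_nat_mult)
  have "(*) y' ` V \<subseteq> X + (V + V)" using X(3) symV by simp
  also have "\<dots> \<subseteq> X + (T + V)" by (rule set_plus_mono2[OF order_refl T(3)])
  also have "\<dots> = (T + X) + V" by (simp add: ac_simps)
  finally have 1: "(*) y' ` V \<subseteq> (T + X) + V" .
  have "real (card (T + X)) \<le> real (card T) * real (card X)"
    using card_set_plus_le[of T X] T X by (metis of_nat_le_iff of_nat_mult)
  also have "\<dots> \<le> real (card T) * (real (card T) * real (card Y))" using cX by (intro mult_left_mono) auto
  also have "\<dots> \<le> K * (K * M)"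
    using T Y K_ge_1 by (intro mult_mono) auto
  finally show ?thesis using 1 T X by (auto simp: good_def mult.assoc intro!: exI[of _ "T + X"] finite_set_plus)
qed

text \<open>
  Let \<open>Q = (B - B)/(B - B)\<close>. If \<open>Q\<close> is closed under adding the unit, it is the whole field.
  Otherwise there is \<open>\<xi> \<in> Q\<close> with \<open>\<xi> + e \<notin> Q\<close>, and then \<open>(u, v) \<mapsto> u + (\<xi> + e) v\<close> is injective
  on \<open>B \<times> B\<close>; clearing the denominator of \<open>\<xi>\<close> makes its values sums of products of elements of \<open>B\<close>.
\<close>

lemma good_growth_step:
  assumes B: "B \<subseteq> F" "2 \<le> card B" and gB: "\<And>b. b \<in> B \<Longrightarrow> good M b" and MK: "K \<le> M"
  shows "(\<forall>x\<in>F. good (M ^ 8) x) \<or>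
    (\<exists>B'\<subseteq>F. card B' = card B ^ 2 \<and> (\<forall>b\<in>B'. good (M ^ 13) b))"
proof -
  have M1: "1 \<le> M" using MK K_ge_1 by simp
  have finB: "finite B" using B finF finite_subset by blast
  \<comment> \<open>The quotients (a - b)/(c - d), written as solutions of an equation because the
    ambient ring has no division.\<close>
  define Q where "Q = {x \<in> F. \<exists>a\<in>B. \<exists>b\<in>B. \<exists>c\<in>B. \<exists>d\<in>B. c \<noteq> d \<and> (c - d) * x = a - b}"
  have "\<exists>c\<in>B. \<exists>d\<in>B. c \<noteq> d"
  proof (rule ccontr)
    assume "\<not> ?thesis"
    then have "card B \<le> Suc 0" using finB by (auto simp: card_le_Suc0_iff_eq)
    then show False using B by simp
  qed
  then have Q0: "0 \<in> Q" using zero_mem by (force simp: Q_def)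
  have gd: "good (M ^ 3) (a - b)" if "a \<in> B" "b \<in> B" for a b
  proof (rule good_mono[OF good_diff[OF gB[OF that(1)] gB[OF that(2)]]])
    show "K * M * M \<le> M ^ 3" using MK M1 by (simp add: power3_eq_cube mult_right_mono)
  qed
  show ?thesis
  proof (cases "\<forall>x\<in>Q. x + e \<in> Q")
    case True
    then have "F \<subseteq> Q" using unit_generates[of Q] Q0 by blast
    have "good (M ^ 8) x" if "x \<in> F" for x
    proof -
      have "x \<in> Q" using that \<open>F \<subseteq> Q\<close> by blast
      then obtain a b c d where abcd: "a \<in> B" "b \<in> B" "c \<in> B" "d \<in> B" "c \<noteq> d" "(c - d) * x = a - b"
        by (auto simp: Q_def)
      have cd: "c - d \<in> F" "c - d \<noteq> 0" using abcd B diff_mem by auto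
      then obtain w where w: "w \<in> F" "(c - d) * w = e" using inverse_ex by blast
      have "x = e * x" using that unit_mult by simp
      also have "\<dots> = w * ((c - d) * x)" using w(2) by (metis mult.assoc mult.commute)
      finally have x: "x = (a - b) * w" using abcd(6) by (simp add: mult.commute)
      have "good (K * K * M ^ 3) w" using good_inverse[OF gd[OF abcd(3,4)] w(2)] .
      then have "good (M ^ 5) w"
      proof (rule good_mono)
        have "K * K * M ^ 3 \<le> M * M * M ^ 3" using MK M1 K_ge_1 by (intro mult_mono) auto
        also have "\<dots> = M ^ 5" by (simp add: eval_nat_numeral)
        finally show "K * K * M ^ 3 \<le> M ^ 5" .
      qed
      \<comment> \<open>The numerator costs M^3 and the inverted denominator M^5, hence the exponent
        8.\<close>
      from good_mult[OF gd[OF abcd(1,2)] this] show ?thesis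
        unfolding x by (simp flip: power_add)
    qed
    then show ?thesis by blast
  next
    case False
    then obtain \<xi> where \<xi>: "\<xi> \<in> Q" "\<xi> + e \<notin> Q" by blast
    then obtain a b c d where abcd: "a \<in> B" "b \<in> B" "c \<in> B" "d \<in> B" "c \<noteq> d" "(c - d) * \<xi> = a - b"
      by (auto simp: Q_def)
    have \<xi>F: "\<xi> \<in> F" using \<xi> by (simp add: Q_def)
    have cd: "c - d \<in> F" "c - d \<noteq> 0" using abcd B diff_mem by auto
    define r where "r = (a - b) + (c - d)"
    have rF: "r \<in> F" unfolding r_def using abcd B by (intro add_mem diff_mem) auto
    have r: "r = (c - d) * (\<xi> + e)"
      using abcd(6) unit_mult[OF cd(1)] by (simp add: r_def distrib_left mult.commute)
    define f where "f = (\<lambda>(u,v). (c - d) * u + r * v)"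
    have inj: "inj_on f (B \<times> B)"
    proof (rule inj_onI, clarify)
      fix u v u' v' assume uv: "u \<in> B" "v \<in> B" "u' \<in> B" "v' \<in> B" and eq: "f (u,v) = f (u',v')"
      have uvF: "u \<in> F" "v \<in> F" "u' \<in> F" "v' \<in> F" using uv B by auto
      have "(c - d) * ((v' - v) * (\<xi> + e)) = r * (v' - v)"
        unfolding r by (simp add: ac_simps)
      also have "\<dots> = (c - d) * (u - u')"
        using eq by (simp add: f_def algebra_simps)
      finally have *: "(v' - v) * (\<xi> + e) = u - u'"
        using mult_left_cancel_mem[OF cd] uvF \<xi>F
        by (meson add_mem diff_mem mult_mem unit_mem)
      \<comment> \<open>Otherwise \<open>\<xi> + e\<close> would be the quotient (u - u')/(v' - v)
        and so belong to \<open>Q\<close>.\<close>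
      have "v' = v"
      proof (rule ccontr)
        assume "v' \<noteq> v"
        then have "\<xi> + e \<in> Q" using * uv \<xi>F unit_mem add_mem by (auto simp: Q_def)
        then show False using \<xi> by simp
      qed
      then show "u = u' \<and> v = v'" using * by simp
    qed
    define B' where "B' = f ` (B \<times> B)"
    have "card B' = card B ^ 2"
      using inj by (simp add: B'_def card_image card_cartesian_product power2_eq_square)
    moreover have "B' \<subseteq> F"
      using B cd(1) rF by (auto simp: B'_def f_def intro!: add_mem mult_mem)
    moreover have "good (M ^ 13) w" if w: "w \<in> B'" for w
    proof -
      obtain u v where uv: "u \<in> B" "v \<in> B" "w = (c - d) * u + r * v" using w by (auto simp: B'_def f_def)
      have 1: "good (M ^ 3 * M) ((c - d) * u)" using good_mult[OF gd[OF abcd(3,4)] gB[OF uv(1)]] .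
      have "good (K * M^3 * M^3) r" unfolding r_def by (intro good_add gd abcd)
      then have "good (K * M^3 * M^3 * M) (r * v)" using good_mult gB[OF uv(2)] by blast
      \<comment> \<open>As \<open>K\<close> is at most \<open>M\<close>, the outer sum costs M, the
        first product M^4 and the second M^8, together M^13.\<close>
      from good_add[OF 1 this] have "good (K * (M ^ 3 * M) * (K * M ^ 3 * M ^ 3 * M)) w" using uv by simp
      then show ?thesis
      proof (rule good_mono)
        have "K * (M ^ 3 * M) * (K * M ^ 3 * M ^ 3 * M) \<le> M * (M ^ 3 * M) * (M * M ^ 3 * M ^ 3 * M)"
          using MK M1 K_ge_1 by (intro mult_mono) auto
        also have "\<dots> = M ^ 13" by (simp add: eval_nat_numeral)
        finally show "K * (M ^ 3 * M) * (K * M ^ 3 * M ^ 3 * M) \<le> M ^ 13" .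
      qed
    qed
    ultimately show ?thesis by blast
  qed
qed

text \<open>Each growth step either makes all of \<open>F\<close> good or squares the size of
  \<open>B\<close> at the price of a 13th power. Since |B|^(2^i) exceeds |F|, squaring i times is
  impossible, so the first alternative occurs within i steps.\<close>

lemma good_growth:
  assumes "B \<subseteq> F" "2 \<le> card B" "\<And>b. b \<in> B \<Longrightarrow> good M b" "K \<le> M"
    and "card F < card B ^ (2 ^ i)" and "x \<in> F"
  shows "good (M ^ (8 * 13 ^ i)) x"
  using assms
proof (induction i arbitrary: B M)
  case 0
  then have "card B \<le> card F" using finF by (intro card_mono) auto
  then show ?case using 0 by simp
next
  case (Suc i)
  have M1: "1 \<le> M" using Suc.prems K_ge_1 by simp
  consider "good (M ^ 8) x" | B' where "B' \<subseteq> F" "card B' = card B ^ 2" "\<forall>b\<in>B'. good (M ^ 13) b"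
    using good_growth_step[OF Suc.prems(1,2) Suc.prems(3,4)] Suc.prems(6) by blast
  then show ?case
  proof cases
    case 1
    then show ?thesis by (rule good_mono) (use M1 in \<open>auto intro: power_increasing\<close>)
  next
    case 2
    have "2 * 1 \<le> card B * card B" using Suc.prems(2) by (intro mult_mono) auto
    then have "2 \<le> card B'" using 2 by (simp add: power2_eq_square)
    moreover have "K \<le> M ^ 13"
      using Suc.prems(4) self_le_power[OF M1, of 13] by simp
    moreover have "card F < card B' ^ 2 ^ i"
      using Suc.prems(5) 2 by (simp flip: power_mult add: mult.commute)
    ultimately have "good ((M ^ 13) ^ (8 * 13 ^ i)) x"
      using Suc.IH[of B' "M ^ 13"] 2 Suc.prems(6) by blast
    then show ?thesis by (simp flip: power_mult add: ac_simps)
  qed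
qed

text \<open>
  Double counting of the triples \<open>(x, v, v')\<close> with \<open>v \<noteq> v'\<close> and \<open>x (v - v') \<in> V + V\<close>.
\<close>

lemma all_good_size_bound:
  assumes all: "\<And>x. x \<in> F \<Longrightarrow> good M x" and big: "2 * M ^ 2 \<le> real (card V)"
  shows "real (card F) - 1 \<le> 2 * M ^ 2 * K * real (card V)"
proof -
  define D where "D = V + V"
  define P where "P = {z \<in> V \<times> V. fst z \<noteq> snd z}"
  define v where "v = real (card V)"
  have vpos: "v > 0" using cardV_pos by (simp add: v_def)
  have M1: "1 \<le> M" using good_ge_1 all zero_mem by blast
  have finP: "finite P" using finV by (simp add: P_def)
  have lower: "v ^ 2 / M ^ 2 - v \<le> real (card {z \<in> P. x * (fst z - snd z) \<in> D})" if x: "x \<in> F - {0}" for x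
  proof -
    obtain T where T: "finite T" "real (card T) \<le> M" "(*) x ` V \<subseteq> T + V" using all[of x] x unfolding good_def by blast
    \<comment> \<open>By pigeonhole, one translate t + V contains x w for at least v/M of the w in
      \<open>V\<close>. Any two such w satisfy x (w - w') in V - V = V + V; removing the diagonal
      costs at most v.\<close>
    define W where "W t = {w \<in> V. x * w - t \<in> V}" for t
    have "V \<subseteq> (\<Union>t\<in>T. W t)"
    proof
      fix w assume "w \<in> V"
      then have "x * w \<in> T + V" using T(3) by blast
      then obtain t u where "t \<in> T" "u \<in> V" "x * w = t + u" by (auto simp: set_plus_def)
      then show "w \<in> (\<Union>t\<in>T. W t)" using \<open>w \<in> V\<close> by (auto simp: W_def intro!: bexI[of _ t])
    qed
    then have "card V \<le> card (\<Union>t\<in>T. W t)" using T finV by (intro card_mono) (auto simp: W_def)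
    also have "\<dots> \<le> (\<Sum>t\<in>T. card (W t))" using T(1) by (rule card_UN_le)
    finally have s: "v \<le> (\<Sum>t\<in>T. real (card (W t)))" unfolding v_def by (metis of_nat_le_iff of_nat_sum)
    have "\<exists>t\<in>T. v / M \<le> real (card (W t))"
    proof (rule ccontr)
      assume no: "\<not> ?thesis"
      have "T \<noteq> {}" using s vpos by auto
      then have "(\<Sum>t\<in>T. real (card (W t))) < (\<Sum>t\<in>T. v / M)"
        using no T(1) by (intro sum_strict_mono) auto
      also have "\<dots> = real (card T) * (v / M)" by simp
      also have "\<dots> \<le> M * (v / M)" using T(2) vpos M1 by (intro mult_right_mono) auto
      also have "\<dots> = v" using M1 by simp
      finally show False using s by simp
    qed
    then obtain t where t: "v / M \<le> real (card (W t))" by blast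
    have finW: "finite (W t)" using finV by (simp add: W_def)
    have "W t \<times> W t \<subseteq> {z \<in> P. x * (fst z - snd z) \<in> D} \<union> (\<lambda>w. (w,w)) ` V"
    proof clarsimp
      fix a b assume ab: "a \<in> W t" "b \<in> W t" "(a, b) \<notin> (\<lambda>w. (w,w)) ` V"
      then have "x * b - t \<in> V" by (simp add: W_def)
      then have "- (x * b - t) \<in> uminus ` V" by (rule imageI)
      then have "- (x * b - t) \<in> V" unfolding symV .
      then have "(x * a - t) + (- (x * b - t)) \<in> D" using ab unfolding D_def by (intro set_plus_intro) (simp_all add: W_def)
      moreover have "(x * a - t) + (- (x * b - t)) = x * (a - b)" by (simp add: algebra_simps)
      ultimately show "(a, b) \<in> P \<and> x * (a - b) \<in> D" using ab by (auto simp: P_def W_def)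
    qed
    then have "card (W t \<times> W t) \<le> card ({z \<in> P. x * (fst z - snd z) \<in> D} \<union> (\<lambda>w. (w,w)) ` V)"
      using finP finV by (intro card_mono) auto
    also have "\<dots> \<le> card {z \<in> P. x * (fst z - snd z) \<in> D} + card ((\<lambda>w. (w,w)) ` V)" by (rule card_Un_le)
    also have "card ((\<lambda>w. (w,w)) ` V) \<le> card V" using finV by (rule card_image_le)
    finally have "card (W t) * card (W t) \<le> card {z \<in> P. x * (fst z - snd z) \<in> D} + card V"
      by (simp add: card_cartesian_product)
    then have "real (card (W t) * card (W t)) \<le> real (card {z \<in> P. x * (fst z - snd z) \<in> D} + card V)"
      by (rule of_nat_mono)
    then have "real (card (W t)) ^ 2 \<le> real (card {z \<in> P. x * (fst z - snd z) \<in> D}) + v"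
      by (simp add: v_def power2_eq_square)
    moreover have "(v / M) ^ 2 \<le> real (card (W t)) ^ 2" using t vpos M1 by (intro power_mono) auto
    ultimately show ?thesis by (simp add: power_divide)
  qed
  \<comment> \<open>For a fixed pair, x is determined by the product x (v - v'), which ranges over
    \<open>D\<close>.\<close>
  have upper: "(\<Sum>x\<in>F - {0}. real (card {z \<in> P. x * (fst z - snd z) \<in> D})) \<le> v ^ 2 * (K * v)"
  proof -
    have cD: "real (card D) \<le> K * v"
    proof -
      obtain T where T: "finite T" "real (card T) \<le> K" "V + V \<subseteq> T + V" using doubling by blast
      have "card D \<le> card (T + V)" unfolding D_def using T finV by (intro card_mono finite_set_plus) auto
      also have "\<dots> \<le> card T * card V" using T finV by (intro card_set_plus_le) auto
      finally have "real (card D) \<le> real (card T) * v" unfolding v_def by (metis of_nat_le_iff of_nat_mult)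
      also have "\<dots> \<le> K * v" using T vpos by (intro mult_right_mono) auto
      finally show ?thesis .
    qed
    have "(\<Sum>x\<in>F - {0}. card {z \<in> P. x * (fst z - snd z) \<in> D}) =
        (\<Sum>z\<in>P. card {x \<in> F - {0}. x * (fst z - snd z) \<in> D})"
      by (rule sum_multicount_gen) (use finF finP in auto)
    then have "(\<Sum>x\<in>F - {0}. real (card {z \<in> P. x * (fst z - snd z) \<in> D})) =
        (\<Sum>z\<in>P. real (card {x \<in> F - {0}. x * (fst z - snd z) \<in> D}))"
      by (metis (mono_tags, lifting) of_nat_sum sum.cong)
    also have "\<dots> \<le> (\<Sum>z\<in>P. real (card D))"
    proof (intro sum_mono of_nat_mono)
      fix z assume z: "z \<in> P"
      then have zF: "fst z - snd z \<in> F" "fst z - snd z \<noteq> 0" using VF by (auto simp: P_def intro!: diff_mem)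
      have "inj_on (\<lambda>x. x * (fst z - snd z)) {x \<in> F - {0}. x * (fst z - snd z) \<in> D}"
        using mult_left_cancel_mem[OF zF] by (auto simp: inj_on_def mult.commute)
      then show "card {x \<in> F - {0}. x * (fst z - snd z) \<in> D} \<le> card D"
        by (rule card_inj_on_le) (use finV in \<open>auto simp: D_def finite_set_plus\<close>)
    qed
    also have "\<dots> = real (card P) * real (card D)" by simp
    also have "\<dots> \<le> v ^ 2 * (K * v)"
    proof (intro mult_mono cD)
      have "card P \<le> card (V \<times> V)" using finV by (intro card_mono) (auto simp: P_def)
      then show "real (card P) \<le> v ^ 2"
        unfolding v_def card_cartesian_product power2_eq_square by (metis of_nat_le_iff of_nat_mult)
    qed auto
    finally show ?thesis .
  qed
  have cF: "real (card (F - {0})) = real (card F) - 1"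
  proof -
    have "card F > 0" using finF zero_mem by (auto simp: card_gt_0_iff)
    then show ?thesis using finF zero_mem by (simp add: card_Diff_singleton of_nat_diff)
  qed
  \<comment> \<open>The assumption \<open>big\<close> makes the diagonal loss v at most half of v^2
    / M^2.\<close>
  have "v * M ^ 2 * 2 \<le> v * v" using big vpos by (simp add: v_def)
  then have "v ^ 2 / (2 * M ^ 2) \<le> v ^ 2 / M ^ 2 - v"
    using M1 by (simp add: field_simps power2_eq_square)
  then have "(real (card F) - 1) * (v ^ 2 / (2 * M ^ 2)) \<le> (real (card F) - 1) * (v ^ 2 / M ^ 2 - v)"
    using cF by (intro mult_left_mono) (metis, metis of_nat_0_le_iff)
  also have "\<dots> = (\<Sum>x\<in>F - {0}. v ^ 2 / M ^ 2 - v)" using cF by simp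
  also have "\<dots> \<le> v ^ 2 * (K * v)" using upper lower by (meson order_trans sum_mono)
  finally have "v ^ 2 * (real (card F) - 1) \<le> v ^ 2 * (2 * M ^ 2 * K * v)"
    using M1 by (simp add: field_simps)
  then show ?thesis using vpos by (simp add: v_def)
qed

end

section \<open>Approximate groups from sets invariant under a multiplicative subgroup\<close>

text \<open>Cauchy-Schwarz for the number d a of sets containing a. These numbers add up to |H| N,
  so their squares, which count all pairwise intersections, add up to at least (|H| N)^2 / |A|; some
  h' carries at least the average share.\<close>

lemma ex_large_sum_card_Int:
  fixes X :: "'b \<Rightarrow> 'a set"
  assumes A: "finite A" and H: "finite H" "H \<noteq> {}" and X: "\<And>h. h \<in> H \<Longrightarrow> X h \<subseteq> A" "\<And>h. h \<in> H \<Longrightarrow> card (X h) = N"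
  shows "\<exists>h'\<in>H. real (card H) * real N ^ 2 \<le> real (card A) * (\<Sum>h\<in>H. real (card (X h \<inter> X h')))"
proof -
  define d where "d a = real (card {h \<in> H. a \<in> X h})" for a
  define n where "n = real (card H)"
  have npos: "n > 0" using H by (simp add: n_def card_gt_0_iff)
  have fX: "finite (X h)" if "h \<in> H" for h using X A that finite_subset by blast
  have sum1: "(\<Sum>a\<in>A. d a) = n * real N"
  proof -
    have "(\<Sum>a\<in>A. card {h \<in> H. a \<in> X h}) = (\<Sum>h\<in>H. card {a \<in> A. a \<in> X h})"
      by (rule sum_multicount_gen) (use A H in auto)
    also have "\<dots> = (\<Sum>h\<in>H. N)"
    proof (intro sum.cong refl)
      fix h assume "h \<in> H"
      then have "{a \<in> A. a \<in> X h} = X h" using X by auto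
      then show "card {a \<in> A. a \<in> X h} = N" using X \<open>h \<in> H\<close> by simp
    qed
    finally have "real (\<Sum>a\<in>A. card {h \<in> H. a \<in> X h}) = real (\<Sum>h\<in>H. N)" by (rule arg_cong)
    then show ?thesis by (simp add: d_def n_def)
  qed
  have sum2: "(\<Sum>h'\<in>H. \<Sum>h\<in>H. real (card (X h \<inter> X h'))) = (\<Sum>a\<in>A. d a ^ 2)"
  proof -
    have "(\<Sum>z\<in>H \<times> H. card {a \<in> A. a \<in> X (fst z) \<inter> X (snd z)}) = (\<Sum>a\<in>A. card {z \<in> H \<times> H. a \<in> X (fst z) \<inter> X (snd z)})"
      by (rule sum_multicount_gen) (use A H in auto)
    also have "\<dots> = (\<Sum>a\<in>A. card ({h \<in> H. a \<in> X h} \<times> {h \<in> H. a \<in> X h}))"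
      by (intro sum.cong refl arg_cong[where f=card]) auto
    finally have "real (\<Sum>z\<in>H \<times> H. card {a \<in> A. a \<in> X (fst z) \<inter> X (snd z)}) =
        real (\<Sum>a\<in>A. card ({h \<in> H. a \<in> X h} \<times> {h \<in> H. a \<in> X h}))" by (rule arg_cong)
    then have "(\<Sum>z\<in>H \<times> H. real (card {a \<in> A. a \<in> X (fst z) \<inter> X (snd z)})) = (\<Sum>a\<in>A. d a ^ 2)"
      by (simp only: of_nat_sum card_cartesian_product of_nat_mult d_def power2_eq_square)
    moreover have "(\<Sum>z\<in>H \<times> H. real (card {a \<in> A. a \<in> X (fst z) \<inter> X (snd z)})) =
        (\<Sum>z\<in>H \<times> H. real (card (X (snd z) \<inter> X (fst z))))"
    proof (intro sum.cong refl)
      fix z assume "z \<in> H \<times> H"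
      then have "{a \<in> A. a \<in> X (fst z) \<inter> X (snd z)} = X (snd z) \<inter> X (fst z)" using X(1)[of "fst z"] by auto
      then show "real (card {a \<in> A. a \<in> X (fst z) \<inter> X (snd z)}) = real (card (X (snd z) \<inter> X (fst z)))" by simp
    qed
    ultimately show ?thesis by (simp add: sum.cartesian_product case_prod_unfold)
  qed
  have cs: "(n * real N)^2 \<le> real (card A) * (\<Sum>h'\<in>H. \<Sum>h\<in>H. real (card (X h \<inter> X h')))"
    unfolding sum2 sum1[symmetric] using sum_squared_le_sum_of_squares[of d A] A by (simp add: mult.commute)
  show ?thesis
  proof (rule ccontr)
    assume "\<not> ?thesis"
    then have "(\<Sum>h'\<in>H. real (card A) * (\<Sum>h\<in>H. real (card (X h \<inter> X h')))) < (\<Sum>h'\<in>H. n * real N ^ 2)"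
      using H by (intro sum_strict_mono) (auto simp: n_def not_le)
    also have "\<dots> = (n * real N)^2" by (simp add: n_def power2_eq_square)
    finally show False using cs by (simp add: sum_distrib_left)
  qed
qed

locale subgroup_in_field = prime_field_in_ring F e for F :: "'a::comm_ring_1 set" and e +
  fixes H :: "'a set"
  assumes HF: "H \<subseteq> F" and unit_H: "e \<in> H" and zero_H: "0 \<notin> H"
    and mult_H: "g \<in> H \<Longrightarrow> h \<in> H \<Longrightarrow> g * h \<in> H"
    and inverse_H: "h \<in> H \<Longrightarrow> \<exists>h'\<in>H. h * h' = e"
begin

lemma finH: "finite H" using HF finF finite_subset by blast

lemma cardH_pos: "0 < card H" using finH unit_H by (auto simp: card_gt_0_iff)

lemma inj_on_mult_H: "h \<in> H \<Longrightarrow> X \<subseteq> F \<Longrightarrow> inj_on ((*) h) X"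
  by (rule inj_onI, rule mult_left_cancel_mem[of h]) (use HF zero_H in auto)

text \<open>By invariance all dilates h A' lie in \<open>A\<close>, each with density at least
  \<beta>, so some h' A' meets them in at least \<beta> |A'| elements on average. Hence a proportion
  \<beta>/2 of them meet it in at least \<beta>/2 |A'| elements; dividing by h' turns these overlaps
  into overlaps of A' with its own dilates.\<close>

lemma many_self_overlapping_dilates:
  assumes A: "A \<subseteq> F" and inv: "\<And>h a. h \<in> H \<Longrightarrow> a \<in> A \<Longrightarrow> h * a \<in> A"
    and A': "A' \<subseteq> A" "A' \<noteq> {}" and \<beta>: "0 < \<beta>" "\<beta> * real (card A) \<le> real (card A')"
  shows "\<beta>/2 * real (card H) \<le> real (card {g \<in> H. \<beta>/2 * real (card A') \<le> real (card (A' \<inter> (*) g ` A'))})"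
proof -
  define N where "N = card A'"
  define n where "n = real (card H)"
  define X where "X h = (*) h ` A'" for h
  have finA: "finite A" using A finF finite_subset by blast
  have A'F: "A' \<subseteq> F" using A' A by blast
  have finA': "finite A'" using finA A' finite_subset by blast
  have Npos: "real N > 0" using finA' A' by (simp add: N_def card_gt_0_iff)
  have npos: "n > 0" using cardH_pos by (simp add: n_def)
  have Apos: "real (card A) > 0" using finA A' by (auto simp: card_gt_0_iff)
  have XA: "X h \<subseteq> A" if "h \<in> H" for h using inv that A' by (auto simp: X_def)
  have cX: "card (X h) = N" if "h \<in> H" for h
    unfolding X_def N_def using inj_on_mult_H[OF that A'F] by (rule card_image)
  obtain h' where h': "h' \<in> H" "n * real N ^ 2 \<le> real (card A) * (\<Sum>h\<in>H. real (card (X h \<inter> X h')))"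
    using ex_large_sum_card_Int[of A H X N] finA finH unit_H XA cX unfolding n_def by blast
  define \<Sigma> where "\<Sigma> = (\<Sum>h\<in>H. real (card (X h \<inter> X h')))"
  have "real (card A) * (\<beta> * (n * real N)) \<le> real N * (n * real N)"
    using \<beta>(2) npos Npos by (simp add: N_def mult.commute mult.left_commute)
  also have "\<dots> \<le> real (card A) * \<Sigma>" using h'(2) by (simp add: \<Sigma>_def power2_eq_square ac_simps)
  finally have \<Sigma>: "\<beta> * (n * real N) \<le> \<Sigma>" using Apos by simp
  define G where "G = {h \<in> H. \<beta>/2 * real N \<le> real (card (X h \<inter> X h'))}"
  have finG: "finite G" using finH by (simp add: G_def)
  have "\<Sigma> = (\<Sum>h\<in>H - G. real (card (X h \<inter> X h'))) + (\<Sum>h\<in>G. real (card (X h \<inter> X h')))"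
    unfolding \<Sigma>_def using finH by (intro sum.subset_diff) (auto simp: G_def)
  also have "(\<Sum>h\<in>G. real (card (X h \<inter> X h'))) \<le> (\<Sum>h\<in>G. real N)"
  proof (intro sum_mono of_nat_mono)
    fix h assume "h \<in> G"
    then have "h \<in> H" by (simp add: G_def)
    then show "card (X h \<inter> X h') \<le> N"
      using cX[of h] finA' by (metis Int_lower1 X_def card_mono finite_imageI)
  qed
  also have "(\<Sum>h\<in>H - G. real (card (X h \<inter> X h'))) \<le> (\<Sum>h\<in>H - G. \<beta>/2 * real N)"
    by (intro sum_mono) (auto simp: G_def)
  also have "(\<Sum>h\<in>H - G. \<beta>/2 * real N) \<le> n * (\<beta>/2 * real N)"
    unfolding sum_constant n_def using finH \<beta> Npos by (intro mult_right_mono of_nat_mono card_mono) auto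
  finally have "\<Sigma> \<le> n * (\<beta>/2 * real N) + real (card G) * real N" by simp
  then have "real N * (\<beta>/2 * n) \<le> real N * real (card G)" using \<Sigma> by (simp add: algebra_simps)
  then have G: "\<beta>/2 * n \<le> real (card G)" using Npos by (simp only: mult_le_cancel_left_pos)
  obtain k where k: "k \<in> H" "h' * k = e" using inverse_H h' by blast
  have "card G \<le> card {g \<in> H. \<beta>/2 * real N \<le> real (card (A' \<inter> (*) g ` A'))}"
  proof (rule card_inj_on_le)
    show "inj_on ((*) k) G" using HF by (intro inj_on_mult_H[OF k(1)]) (auto simp: G_def)
    show "(*) k ` G \<subseteq> {g \<in> H. \<beta>/2 * real N \<le> real (card (A' \<inter> (*) g ` A'))}"
    proof clarify
      fix h assume h: "h \<in> G"
      then have hH: "h \<in> H" by (simp add: G_def)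
      have "\<beta>/2 * real N \<le> real (card (X h \<inter> X h'))" using h by (simp add: G_def)
      also have "card (X h \<inter> X h') = card ((*) k ` (X h \<inter> X h'))"
        using inj_on_mult_H[OF k(1)] XA[OF hH] A by (subst card_image) (auto intro: inj_on_subset)
      also have "\<dots> \<le> card (A' \<inter> (*) (k * h) ` A')"
      proof (intro card_mono)
        have "k * (h' * a) = a" if "a \<in> A'" for a
          using k(2) unit_mult[of a] that A'F by (metis mult.assoc mult.commute subsetD)
        then show "(*) k ` (X h \<inter> X h') \<subseteq> A' \<inter> (*) (k * h) ` A'"
          by (auto simp: X_def mult.assoc)
      qed (use finA' in auto)
      finally show "k * h \<in> H \<and> \<beta>/2 * real N \<le> real (card (A' \<inter> (*) (k * h) ` A'))"
        using mult_H[OF k(1) hH] by simp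
    qed
  qed (use finH in auto)
  then show ?thesis using G unfolding n_def N_def by linarith
qed

text \<open>\<open>V\<close> is S + S for the popular differences \<open>S\<close> of A', whose
  iterated sums stay small. If A' and g A' overlap in a large set Z, the popular differences of Z
  lie in both S and g S. Adding them to g V thus stays inside g (S + S + S), and Ruzsa's covering
  lemma covers g V by translates of \<open>V\<close>.\<close>

lemma exists_approx_group:
  assumes A: "A \<subseteq> F" and inv: "\<And>h a. h \<in> H \<Longrightarrow> a \<in> A \<Longrightarrow> h * a \<in> A"
    and A': "A' \<subseteq> A" "A' \<noteq> {}" and \<beta>: "0 < \<beta>" "\<beta> * real (card A) \<le> real (card A')"
    and K: "real (card (A' + uminus ` A')) \<le> K * real (card A')"
  defines "\<rho> \<equiv> \<beta> / 2"
  defines "q \<equiv> 2 * K^2 / \<rho>^2"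
  defines "M \<equiv> q^5 * (2 / \<rho>)"
  shows "\<exists>V B. approx_group_in_field F e V M \<and> B \<subseteq> H \<and> \<rho> * real (card H) \<le> real (card B) \<and>
    (\<forall>b\<in>B. approx_group_in_field.good V M b) \<and>
    \<rho>/2 * real (card A') \<le> real (card V) \<and> real (card V) \<le> M * real (card A')"
proof -
  define N where "N = real (card A')"
  define D where "D = A' + uminus ` A'"
  \<comment> \<open>Chosen so that 2 c |D| is at most (\<rho> N)^2: every subset of A' with at least
    \<rho> N elements then still has many differences that are popular at this level.\<close>
  define c where "c = \<rho>^2 / (2 * K) * N"
  define S where "S = popular_diffs c A'"
  define B where "B = {g \<in> H. \<rho> * N \<le> real (card (A' \<inter> (*) g ` A'))}"
  have finA: "finite A" using A finF finite_subset by blast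
  have A'F: "A' \<subseteq> F" using A' A by blast
  have finA': "finite A'" using finA A' finite_subset by blast
  have Npos: "N > 0" using finA' A' by (simp add: N_def card_gt_0_iff)
  have finD: "finite D" unfolding D_def using finA' by (intro finite_set_plus) auto
  have DF: "D \<subseteq> F" using A'F by (auto simp: D_def set_plus_def intro!: diff_mem)
  have "N \<le> real (card D)" unfolding N_def D_def
    using card_le_card_set_plus[of A' "uminus ` A'"] finA' A' by auto
  then have "1 * N \<le> K * N" using K by (simp add: D_def N_def)
  then have K1: "1 \<le> K" using Npos by (simp only: mult_le_cancel_right_pos)
  have "card A' \<le> card A" using A' finA by (simp add: card_mono)
  then have "\<beta> * real (card A) \<le> 1 * real (card A)" using \<beta> by linarith
  moreover have "real (card A) > 0" using finA A' by (auto simp: card_gt_0_iff)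
  ultimately have "\<beta> \<le> 1" by (simp only: mult_le_cancel_right_pos)
  then have \<rho>: "0 < \<rho>" "\<rho> \<le> 1/2" using \<beta> by (auto simp: \<rho>_def)
  have \<rho>2: "\<rho>^2 \<le> 1" using \<rho> by (simp add: power_le_one)
  have K2: "1 \<le> K^2" using K1 by (rule one_le_power)
  have q1: "1 \<le> q" using \<rho> \<rho>2 K2 by (simp add: q_def field_simps)
  have cpos: "c > 0" using \<rho> K1 Npos by (simp add: c_def)
  have "\<rho>^2 / (2 * K) \<le> 1" using \<rho>2 K1 \<rho> by (simp add: field_simps)
  then have cN: "c \<le> N" using mult_right_mono[of "\<rho>^2 / (2 * K)" 1 N] Npos by (simp add: c_def)
  have finS: "finite S" unfolding S_def using finA' cpos by (rule finite_popular_diffs)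
  have SD: "S \<subseteq> D" unfolding S_def D_def using cpos by (rule popular_diffs_subset)
  have SF: "S \<subseteq> F" using SD DF by blast
  have symS: "uminus ` S = S" unfolding S_def by (rule uminus_popular_diffs)
  have zeroS: "0 \<in> S" using cN by (simp add: S_def popular_diffs_def N_def)
  have step: "real (card (A' + (S + Y))) \<le> q * real (card (A' + Y))" if "finite Y" for Y
  proof -
    have "real (card (A' + (S + Y))) * c \<le> real (card D) * real (card (A' + Y))"
      using card_plus_popular_diffs_plus[OF finA' cpos finA' that] by (simp add: S_def D_def)
    also have "\<dots> \<le> (K * N) * real (card (A' + Y))" using K by (intro mult_right_mono) (auto simp: D_def N_def)
    also have "K * N = q * c" using K1 \<rho> by (simp add: q_def c_def field_simps power2_eq_square)
    finally have "real (card (A' + (S + Y))) * c \<le> (q * real (card (A' + Y))) * c" by (simp add: ac_simps)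
    then show ?thesis using cpos by simp
  qed
  have s1: "real (card (A' + S)) \<le> q * N"
    using step[of "{0}"] by (simp add: N_def)
  have iter: "real (card (A' + (S + Y))) \<le> q^(Suc k) * N" if "finite Y" "real (card (A' + Y)) \<le> q^k * N" for Y k
  proof -
    have "real (card (A' + (S + Y))) \<le> q * real (card (A' + Y))" using step that by blast
    also have "\<dots> \<le> q * (q^k * N)" using that q1 by (intro mult_left_mono) auto
    finally show ?thesis by (simp add: mult.assoc)
  qed
  \<comment> \<open>Sums of up to five copies of \<open>S\<close> are needed: four make up V + V,
    and Ruzsa's covering lemma adds a fifth.\<close>
  have fS: "finite (S + S)" "finite (S + (S + S))" "finite (S + (S + (S + S)))" "finite (S + (S + (S + (S + S))))"
    using finS by (auto intro!: finite_set_plus)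
  have s2: "real (card (A' + (S + S))) \<le> q^2 * N"
    using iter[OF finS, of 1] s1 by (simp add: numeral_2_eq_2)
  have s3: "real (card (A' + (S + (S + S)))) \<le> q^3 * N"
    using iter[OF fS(1), of 2] s2 by (simp add: eval_nat_numeral)
  have s4: "real (card (A' + (S + (S + (S + S))))) \<le> q^4 * N"
    using iter[OF fS(2), of 3] s3 by (simp add: eval_nat_numeral)
  have s5: "real (card (A' + (S + (S + (S + (S + S)))))) \<le> q^5 * N"
    using iter[OF fS(3), of 4] s4 by (simp add: eval_nat_numeral)
  obtain a0 where a0: "a0 \<in> A'" using A' by blast
  have drop: "real (card Y) \<le> x" if "finite Y" "real (card (A' + Y)) \<le> x" for Y x
    using card_le_card_set_plus[OF that(1) finA' a0] that(2) by (simp add: add.commute)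
  have popZ: "\<rho>/2 * N \<le> real (card (popular_diffs c Z \<inter> D))" if Z: "Z \<subseteq> A'" "\<rho> * N \<le> real (card Z)" for Z
  proof -
    have "0 < real (card Z)" using Z(2) \<rho> Npos by (meson less_le_trans mult_pos_pos)
    then have Zne: "Z \<noteq> {}" by auto
    have "2 * c * real (card D) \<le> 2 * c * (K * N)" using K cpos by (intro mult_left_mono) (auto simp: D_def N_def)
    also have "\<dots> = (\<rho> * N)^2" using K1 by (simp add: c_def field_simps power2_eq_square)
    also have "\<dots> \<le> real (card Z)^2" using Z(2) \<rho> Npos by (intro power_mono) auto
    finally have sm: "2 * c * real (card D) \<le> real (card Z)^2" .
    have "Z + uminus ` Z \<subseteq> D" unfolding D_def using Z(1) by (intro set_plus_mono2 image_mono)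
    moreover have "finite Z" using Z(1) finA' finite_subset by blast
    ultimately have "real (card Z) \<le> 2 * real (card (popular_diffs c Z \<inter> D))"
      using card_popular_diffs_Int_ge[of Z D c] Zne finD cpos sm by simp
    then show ?thesis using Z(2) by linarith
  qed
  have pmono: "popular_diffs c Z \<subseteq> S" if "Z \<subseteq> A'" for Z
  proof
    fix d assume "d \<in> popular_diffs c Z"
    then have "c \<le> real (card {b \<in> Z. b + d \<in> Z})" by (simp add: popular_diffs_def)
    also have "\<dots> \<le> real (card {b \<in> A'. b + d \<in> A'})"
      using finA' that by (intro of_nat_mono card_mono) auto
    finally show "d \<in> S" by (simp add: S_def popular_diffs_def)
  qed
  have "\<rho> * N \<le> 1 * N" using \<rho> Npos by (intro mult_right_mono) auto
  then have "\<rho>/2 * N \<le> real (card (popular_diffs c A' \<inter> D))" by (intro popZ) (auto simp: N_def)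
  also have "\<dots> \<le> real (card S)" unfolding S_def[symmetric] using finS by (intro of_nat_mono card_mono) auto
  finally have cS: "\<rho>/2 * N \<le> real (card S)" .
  have q5: "0 < q^5" using q1 by simp
  have cover: "\<exists>T. finite T \<and> real (card T) \<le> M \<and> X \<subseteq> T + (S + S)"
    if X: "finite X" and Y: "Y \<subseteq> S" "\<rho>/2 * N \<le> real (card Y)" and XY: "real (card (X + Y)) \<le> q^5 * N" for X Y
  proof -
    have finY: "finite Y" using Y finS finite_subset by blast
    have "0 < real (card Y)" using Y(2) \<rho> Npos by (smt (verit) divide_pos_pos mult_pos_pos)
    then have Yne: "Y \<noteq> {}" by auto
    obtain T where T: "finite T" "card T * card Y \<le> card (X + Y)" "X \<subseteq> T + (Y + uminus ` Y)"
      using ruzsa_covering[OF X finY Yne] by blast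
    have "real (card T) * (\<rho>/2 * N) \<le> real (card T) * real (card Y)" using Y by (intro mult_left_mono) auto
    also have "\<dots> \<le> real (card (X + Y))" using T(2) by (metis of_nat_le_iff of_nat_mult)
    also have "\<dots> \<le> q^5 * N" by (rule XY)
    also have "\<dots> = M * (\<rho>/2 * N)" using \<rho> by (simp add: M_def)
    finally have "real (card T) \<le> M" using \<rho> Npos by simp
    moreover have "T + (Y + uminus ` Y) \<subseteq> T + (S + S)"
    proof -
      have "uminus ` Y \<subseteq> S" using Y(1) symS by blast
      then show ?thesis using Y(1) by (intro set_plus_mono2) auto
    qed
    ultimately show ?thesis using T by blast
  qed
  have ag: "approx_group_in_field F e (S + S) M"
  proof
    show "S + S \<subseteq> F" using SF by (auto simp: set_plus_def intro!: add_mem)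
    have "0 + 0 \<in> S + S" using zeroS by (intro set_plus_intro)
    then show "0 \<in> S + S" by simp
    have "uminus ` (S + S) = uminus ` S + uminus ` S"
      by (force simp: set_plus_def image_iff)
    then show "uminus ` (S + S) = S + S" using symS by simp
    have "(S + S) + (S + S) + S = S + (S + (S + (S + S)))" by (simp add: ac_simps)
    then have "real (card ((S + S) + (S + S) + S)) \<le> q^5 * N" using drop[OF fS(4) s5] by simp
    then show "\<exists>T. finite T \<and> real (card T) \<le> M \<and> (S + S) + (S + S) \<subseteq> T + (S + S)"
      using fS(1) cS by (intro cover[of _ S]) (auto intro: finite_set_plus)
  qed
  have BH: "B \<subseteq> H" by (auto simp: B_def)
  have cB: "\<rho> * real (card H) \<le> real (card B)"
    using many_self_overlapping_dilates[OF A inv A' \<beta>] by (simp add: B_def \<rho>_def N_def)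
  have gB: "approx_group_in_field.good (S + S) M g" if g: "g \<in> B" for g
  proof -
    have gH: "g \<in> H" using g by (simp add: B_def)
    obtain k where k: "k \<in> H" "g * k = e" using inverse_H gH by blast
    have kg: "k * (g * x) = x" "g * (k * x) = x" if "x \<in> F" for x
      using k(2) unit_mult[OF that] by (metis mult.assoc mult.commute)+
    define Z where "Z = A' \<inter> (*) g ` A'"
    define Y where "Y = popular_diffs c Z \<inter> D"
    have ZA': "Z \<subseteq> A'" by (auto simp: Z_def)
    have cY: "\<rho>/2 * N \<le> real (card Y)"
      unfolding Y_def using g by (intro popZ) (auto simp: Z_def B_def)
    have YS: "Y \<subseteq> S" using pmono[OF ZA'] by (auto simp: Y_def)
    \<comment> \<open>Since Z is contained in g A', a popular difference of Z becomes a popular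
      difference of A' after division by g.\<close>
    have YgS: "Y \<subseteq> (*) g ` S"
    proof
      fix d assume d: "d \<in> Y"
      then have dF: "d \<in> F" using DF by (auto simp: Y_def)
      have "c \<le> real (card {b \<in> Z. b + d \<in> Z})" using d by (simp add: Y_def popular_diffs_def)
      also have "\<dots> \<le> real (card {a \<in> A'. a + k * d \<in> A'})"
      proof (intro of_nat_mono card_inj_on_le[where f="(*) k"])
        show "inj_on ((*) k) {b \<in> Z. b + d \<in> Z}" using ZA' A'F by (intro inj_on_mult_H k) auto
        have ZK: "k * z \<in> A'" if "z \<in> Z" for z using that kg A'F by (auto simp: Z_def)
        show "(*) k ` {b \<in> Z. b + d \<in> Z} \<subseteq> {a \<in> A'. a + k * d \<in> A'}"
          using ZK by (auto simp flip: distrib_left)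
      qed (use finA' in auto)
      finally have "k * d \<in> S" by (simp add: S_def popular_diffs_def)
      moreover have "d = g * (k * d)" using kg dF by simp
      ultimately show "d \<in> (*) g ` S" by blast
    qed
    have "(*) g ` (S + S) + Y \<subseteq> (*) g ` (S + S) + (*) g ` S" using YgS by (intro set_plus_mono2) auto
    also have "\<dots> \<subseteq> (*) g ` (S + (S + S))"
      by (auto simp: set_plus_def image_iff) (metis add.commute distrib_left)
    finally have sub: "(*) g ` (S + S) + Y \<subseteq> (*) g ` (S + (S + S))" .
    have "card ((*) g ` (S + S) + Y) \<le> card ((*) g ` (S + (S + S)))" using sub fS(2) by (intro card_mono) auto
    also have "\<dots> \<le> card (S + (S + S))" using fS(2) by (rule card_image_le)
    finally have "real (card ((*) g ` (S + S) + Y)) \<le> q^3 * N" using drop[OF fS(2) s3] by linarith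
    also have "\<dots> \<le> q^5 * N" using q1 Npos by (intro mult_right_mono power_increasing) auto
    finally have "\<exists>T. finite T \<and> real (card T) \<le> M \<and> (*) g ` (S + S) \<subseteq> T + (S + S)"
      using fS(1) YS cY by (intro cover[of _ Y]) auto
    then show ?thesis by (simp add: approx_group_in_field.good_def[OF ag])
  qed
  have "card S \<le> card (S + S)" using card_le_card_set_plus[OF finS finS zeroS] .
  then have lo: "\<rho>/2 * N \<le> real (card (S + S))" using cS by linarith
  have "real (card (S + S)) \<le> q^2 * N" using drop[OF fS(1) s2] .
  also have "\<dots> \<le> q^5 * N" using q1 Npos by (intro mult_right_mono power_increasing) auto
  also have "\<dots> \<le> (q^5 * (2/\<rho>)) * N"
    using \<rho> q5 Npos by (intro mult_right_mono) (auto simp: field_simps)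
  finally have hi: "real (card (S + S)) \<le> M * N" by (simp add: M_def)
  show ?thesis using ag BH cB gB lo hi unfolding N_def by blast
qed

end

section \<open>Exponential sums over a subgroup\<close>

locale subgroup_character = subgroup_in_field F e H for F :: "'a::comm_ring_1 set" and e H +
  fixes \<chi> :: "'a \<Rightarrow> complex"
  assumes char_add: "x \<in> F \<Longrightarrow> y \<in> F \<Longrightarrow> \<chi> (x + y) = \<chi> x * \<chi> y"
    and cmod_char: "x \<in> F \<Longrightarrow> cmod (\<chi> x) = 1"
    and char_orth: "y \<in> F \<Longrightarrow> y \<noteq> 0 \<Longrightarrow> (\<Sum>x\<in>F. \<chi> (x * y)) = 0"
begin

section \<open>Gaussian periods and Parseval's identity\<close>

text \<open>The Gaussian period of \<open>H\<close> at the frequency x, normalised so that the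
  trivial bound is 1.\<close>

definition gsum :: "'a \<Rightarrow> complex" where
  "gsum x = (\<Sum>h\<in>H. \<chi> (h * x)) / of_nat (card H)"

lemma char_0: "\<chi> 0 = 1"
proof -
  have "\<chi> 0 = \<chi> 0 * \<chi> 0" using char_add[OF zero_mem zero_mem] by simp
  moreover have "\<chi> 0 \<noteq> 0" using cmod_char[OF zero_mem] by auto
  ultimately show ?thesis by simp
qed

lemma char_uminus: "x \<in> F \<Longrightarrow> \<chi> (- x) = cnj (\<chi> x)"
proof -
  assume x: "x \<in> F"
  have "\<chi> x * \<chi> (- x) = 1" using char_add[OF x uminus_mem[OF x]] char_0 by simp
  moreover have "\<chi> x * cnj (\<chi> x) = 1" using cmod_char[OF x] by (simp add: complex_norm_square[symmetric])
  moreover have "\<chi> x \<noteq> 0" using cmod_char[OF x] by auto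
  ultimately show ?thesis by (metis mult_left_cancel)
qed

lemma char_diff: "x \<in> F \<Longrightarrow> y \<in> F \<Longrightarrow> \<chi> (x - y) = \<chi> x * cnj (\<chi> y)"
  using char_add[of x "- y"] char_uminus[of y] uminus_mem by simp

lemma gsum_0: "gsum 0 = 1"
  using cardH_pos by (simp add: gsum_def char_0)

lemma gsum_mult_H:
  assumes "h \<in> H" "x \<in> F" shows "gsum (h * x) = gsum x"
proof -
  obtain k where k: "k \<in> H" "h * k = e" using inverse_H assms by blast
  have "(\<Sum>g\<in>H. \<chi> (g * (h * x))) = (\<Sum>g\<in>H. \<chi> (g * x))"
  proof (rule sum.reindex_bij_witness[where i="\<lambda>g. g * k" and j="\<lambda>g. g * h"])
    fix g assume g: "g \<in> H"
    have ge: "g * e = g" using unit_mult[of g] g HF by (auto simp: mult.commute)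
    show "g * h * k = g" using k(2) ge by (simp add: mult.assoc)
    show "g * k * h = g" using k(2) ge by (metis mult.assoc mult.commute)
  qed (use k assms mult_H in \<open>auto simp: mult.assoc\<close>)
  then show ?thesis by (simp add: gsum_def)
qed

lemma cmod_gsum_le_1: "x \<in> F \<Longrightarrow> cmod (gsum x) \<le> 1"
proof -
  assume x: "x \<in> F"
  have "cmod (\<Sum>h\<in>H. \<chi> (h * x)) \<le> (\<Sum>h\<in>H. 1)"
    using x HF by (intro order_trans[OF norm_sum] sum_mono) (auto simp: cmod_char mult_mem)
  then show ?thesis using cardH_pos by (simp add: gsum_def norm_divide)
qed

lemma sum_char_eq:
  assumes "y \<in> F" shows "(\<Sum>x\<in>F. \<chi> (x * y)) = (if y = 0 then of_nat (card F) else 0)"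
  using char_orth[OF assms] by (simp add: char_0)

lemma parseval_set:
  assumes I: "I \<subseteq> F"
  shows "(\<Sum>x\<in>F. cmod (\<Sum>i\<in>I. \<chi> (x * i)) ^ 2) = real (card F) * real (card I)"
proof -
  have finI: "finite I" using I finF finite_subset by blast
  have "complex_of_real (\<Sum>x\<in>F. cmod (\<Sum>i\<in>I. \<chi> (x * i)) ^ 2) =
      (\<Sum>x\<in>F. (\<Sum>i\<in>I. \<chi> (x * i)) * cnj (\<Sum>i\<in>I. \<chi> (x * i)))"
    by (simp only: of_real_sum complex_norm_square)
  also have "\<dots> = (\<Sum>x\<in>F. \<Sum>i\<in>I. \<Sum>j\<in>I. \<chi> (x * (i - j)))"
  proof (intro sum.cong refl)
    fix x assume x: "x \<in> F"
    have "\<chi> (x * i) * cnj (\<chi> (x * j)) = \<chi> (x * (i - j))" if "i \<in> I" "j \<in> I" for i j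
      using char_diff[of "x * i" "x * j"] x that I by (auto simp: mult_mem right_diff_distrib subset_iff)
    then show "(\<Sum>i\<in>I. \<chi> (x * i)) * cnj (\<Sum>i\<in>I. \<chi> (x * i)) = (\<Sum>i\<in>I. \<Sum>j\<in>I. \<chi> (x * (i - j)))"
      unfolding cnj_sum sum_product by (intro sum.cong refl) auto
  qed
  also have "\<dots> = (\<Sum>i\<in>I. \<Sum>x\<in>F. \<Sum>j\<in>I. \<chi> (x * (i - j)))" by (rule sum.swap)
  also have "\<dots> = (\<Sum>i\<in>I. \<Sum>j\<in>I. \<Sum>x\<in>F. \<chi> (x * (i - j)))" by (intro sum.cong refl sum.swap)
  also have "\<dots> = (\<Sum>i\<in>I. \<Sum>j\<in>I. if i = j then of_nat (card F) else 0)"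
    using I by (intro sum.cong refl) (auto simp: sum_char_eq diff_mem subset_iff)
  also have "\<dots> = (\<Sum>i\<in>I. of_nat (card F))"
    using finI by (intro sum.cong refl) (simp add: sum.delta')
  also have "\<dots> = complex_of_real (real (card F) * real (card I))" by simp
  finally show ?thesis by (metis of_real_eq_iff)
qed

lemma parseval_gsum: "(\<Sum>x\<in>F. cmod (gsum x) ^ 2) = real (card F) / real (card H)"
proof -
  have "(\<Sum>x\<in>F. cmod (gsum x) ^ 2) = (\<Sum>x\<in>F. cmod (\<Sum>h\<in>H. \<chi> (x * h)) ^ 2 / real (card H) ^ 2)"
    by (simp add: gsum_def norm_divide power_divide mult.commute)
  also have "\<dots> = (real (card F) * real (card H)) / real (card H) ^ 2"
    using parseval_set[OF HF] by (simp flip: sum_divide_distrib)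
  finally show ?thesis using cardH_pos by (simp add: power2_eq_square)
qed

section \<open>The large spectrum and its differences\<close>

definition spectrum :: "real \<Rightarrow> 'a set" where
  "spectrum t = {x \<in> F. t \<le> cmod (gsum x)}"

lemma spectrum_subset: "spectrum t \<subseteq> F" by (auto simp: spectrum_def)

lemma finite_spectrum: "finite (spectrum t)" using spectrum_subset finF finite_subset by blast

lemma spectrum_mult_H: "h \<in> H \<Longrightarrow> x \<in> spectrum t \<Longrightarrow> h * x \<in> spectrum t"
  using HF by (auto simp: spectrum_def gsum_mult_H mult_mem)

lemma card_spectrum_le:
  assumes "0 \<le> t" shows "real (card (spectrum t)) * t^2 \<le> real (card F) / real (card H)"
proof -
  have "real (card (spectrum t)) * t^2 = (\<Sum>x\<in>spectrum t. t^2)" by simp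
  also have "\<dots> \<le> (\<Sum>x\<in>spectrum t. cmod (gsum x) ^ 2)"
    using assms by (intro sum_mono power_mono) (auto simp: spectrum_def)
  also have "\<dots> \<le> (\<Sum>x\<in>F. cmod (gsum x) ^ 2)"
    using finF spectrum_subset by (intro sum_mono2) auto
  finally show ?thesis by (simp add: parseval_gsum)
qed

text \<open>The orbit of x under \<open>H\<close> stays in the spectrum and is in bijection with
  \<open>H\<close> because x is not zero.\<close>

lemma card_H_le_spectrum:
  assumes "x \<in> spectrum t" "x \<noteq> 0" shows "card H \<le> card (spectrum t)"
proof (rule card_inj_on_le)
  have x: "x \<in> F" using assms spectrum_subset by blast
  show "inj_on (\<lambda>h. h * x) H"
  proof (rule inj_onI)
    fix g h assume gh: "g \<in> H" "h \<in> H" "g * x = h * x"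
    then show "g = h" using mult_left_cancel_mem[OF x assms(2), of g h] HF by (auto simp: mult.commute)
  qed
  show "(\<lambda>h. h * x) ` H \<subseteq> spectrum t" using spectrum_mult_H assms by auto
qed (rule finite_spectrum)

text \<open>Weights \<open>c x\<close> remove the phases of the sums. Exchanging the summations and
  applying Cauchy-Schwarz over \<open>H\<close> gives a square whose expansion produces the
  differences x - y.\<close>

lemma sum_gsum_differences_ge:
  assumes A: "A \<subseteq> F" and t: "0 \<le> t" and large: "\<And>x. x \<in> A \<Longrightarrow> t \<le> cmod (gsum x)"
  shows "t^2 * real (card A)^2 \<le> (\<Sum>x\<in>A. \<Sum>y\<in>A. cmod (gsum (x - y)))"
proof -
  define n where "n = real (card H)"
  have npos: "n > 0" using cardH_pos by (simp add: n_def)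
  define c where "c x = cnj (sgn (gsum x))" for x
  define G where "G h = (\<Sum>x\<in>A. c x * \<chi> (h * x))" for h
  \<comment> \<open>Only an inequality, since \<open>sgn 0 = 0\<close> makes \<open>c x\<close>
    vanish wherever \<open>gsum x\<close> does.\<close>
  have c1: "cmod (c x) \<le> 1" for x by (simp add: c_def norm_sgn)
  have cs: "c x * gsum x = of_real (cmod (gsum x))" for x
    by (cases "gsum x = 0")
       (simp_all add: c_def sgn_eq field_simps complex_norm_square[symmetric] power2_eq_square)
  have nG: "(\<Sum>h\<in>H. \<chi> (h * x)) = of_real n * gsum x" for x
    using npos by (simp add: gsum_def n_def)
  have sumG: "(\<Sum>h\<in>H. G h) = of_real (n * (\<Sum>x\<in>A. cmod (gsum x)))"
  proof -
    have "(\<Sum>h\<in>H. G h) = (\<Sum>x\<in>A. \<Sum>h\<in>H. c x * \<chi> (h * x))" unfolding G_def by (rule sum.swap)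
    also have "\<dots> = (\<Sum>x\<in>A. c x * (of_real n * gsum x))"
      by (simp flip: sum_distrib_left add: nG)
    also have "\<dots> = (\<Sum>x\<in>A. of_real n * of_real (cmod (gsum x)))"
      by (intro sum.cong refl) (metis cs mult.left_commute)
    finally show ?thesis by (simp add: sum_distrib_left)
  qed
  have sumG2: "(\<Sum>h\<in>H. cmod (G h) ^ 2) \<le> n * (\<Sum>x\<in>A. \<Sum>y\<in>A. cmod (gsum (x - y)))"
  proof -
    have "complex_of_real (\<Sum>h\<in>H. cmod (G h) ^ 2) = (\<Sum>h\<in>H. G h * cnj (G h))"
      by (simp add: complex_norm_square[symmetric])
    also have "\<dots> = (\<Sum>h\<in>H. \<Sum>x\<in>A. \<Sum>y\<in>A. c x * cnj (c y) * \<chi> (h * (x - y)))"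
    proof (intro sum.cong refl)
      fix h assume h: "h \<in> H"
      have "c x * \<chi> (h * x) * cnj (c y * \<chi> (h * y)) = c x * cnj (c y) * \<chi> (h * (x - y))"
        if "x \<in> A" "y \<in> A" for x y
        using char_diff[of "h * x" "h * y"] h HF that A by (auto simp: mult_mem right_diff_distrib subset_iff)
      then show "G h * cnj (G h) = (\<Sum>x\<in>A. \<Sum>y\<in>A. c x * cnj (c y) * \<chi> (h * (x - y)))"
        unfolding G_def cnj_sum sum_product by (intro sum.cong refl) auto
    qed
    also have "\<dots> = (\<Sum>x\<in>A. \<Sum>h\<in>H. \<Sum>y\<in>A. c x * cnj (c y) * \<chi> (h * (x - y)))" by (rule sum.swap)
    also have "\<dots> = (\<Sum>x\<in>A. \<Sum>y\<in>A. \<Sum>h\<in>H. c x * cnj (c y) * \<chi> (h * (x - y)))" by (intro sum.cong refl sum.swap)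
    also have "\<dots> = (\<Sum>x\<in>A. \<Sum>y\<in>A. c x * cnj (c y) * (of_real n * gsum (x - y)))"
      by (simp flip: sum_distrib_left add: nG)
    finally have "\<bar>\<Sum>h\<in>H. cmod (G h) ^ 2\<bar> = cmod (\<Sum>x\<in>A. \<Sum>y\<in>A. c x * cnj (c y) * (of_real n * gsum (x - y)))"
      by (metis norm_of_real)
    also have "\<dots> \<le> (\<Sum>x\<in>A. \<Sum>y\<in>A. n * cmod (gsum (x - y)))"
    proof (intro order_trans[OF norm_sum] sum_mono)
      fix x y
      have "cmod (c x) * cmod (c y) \<le> 1 * 1" using c1 by (intro mult_mono) auto
      then have "(cmod (c x) * cmod (c y)) * (n * cmod (gsum (x - y))) \<le> 1 * (n * cmod (gsum (x - y)))"
        using npos by (intro mult_right_mono) auto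
      then show "cmod (c x * cnj (c y) * (of_real n * gsum (x - y))) \<le> n * cmod (gsum (x - y))"
        using npos by (simp add: norm_mult)
    qed
    finally show ?thesis by (simp add: sum_distrib_left)
  qed
  have "(n * (t * real (card A)))^2 \<le> (n * (\<Sum>x\<in>A. cmod (gsum x)))^2"
  proof (intro power_mono mult_left_mono)
    have "(\<Sum>x\<in>A. t) \<le> (\<Sum>x\<in>A. cmod (gsum x))" using large by (rule sum_mono)
    then show "t * real (card A) \<le> (\<Sum>x\<in>A. cmod (gsum x))" by (simp add: mult.commute)
  qed (use npos t in auto)
  also have "\<dots> = cmod (\<Sum>h\<in>H. G h) ^ 2" unfolding sumG norm_of_real by simp
  also have "\<dots> \<le> (\<Sum>h\<in>H. cmod (G h)) ^ 2" by (intro power_mono norm_sum) auto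
  also have "\<dots> \<le> (\<Sum>h\<in>H. cmod (G h) ^ 2) * n"
    unfolding n_def using sum_squared_le_sum_of_squares[of "\<lambda>h. cmod (G h)" H]
    by (simp add: mult.commute)
  also have "\<dots> \<le> n * (\<Sum>x\<in>A. \<Sum>y\<in>A. cmod (gsum (x - y))) * n"
    using sumG2 npos by (intro mult_right_mono) auto
  finally have "n^2 * (t^2 * real (card A)^2) \<le> n^2 * (\<Sum>x\<in>A. \<Sum>y\<in>A. cmod (gsum (x - y)))"
    by (simp add: power_mult_distrib power2_eq_square ac_simps)
  then show ?thesis using npos by simp
qed

text \<open>Pairs whose difference falls outside \<open>spectrum (t^2/2)\<close> account for at most
  half of the lower bound t^2 |A|^2, and every other pair contributes at most 1.\<close>

lemma spectrum_many_differences: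
  assumes t: "0 \<le> t"
  defines "A \<equiv> spectrum t"
  shows "t^2/2 * real (card A)^2 \<le> real (card {z \<in> A \<times> A. fst z - snd z \<in> spectrum (t^2/2)})"
proof -
  define E where "E = {z \<in> A \<times> A. fst z - snd z \<in> spectrum (t^2/2)}"
  have AF: "A \<subseteq> F" unfolding A_def by (rule spectrum_subset)
  have finA: "finite A" unfolding A_def by (rule finite_spectrum)
  have EA: "E \<subseteq> A \<times> A" by (auto simp: E_def)
  have "t^2 * real (card A)^2 \<le> (\<Sum>x\<in>A. \<Sum>y\<in>A. cmod (gsum (x - y)))"
    using AF t by (rule sum_gsum_differences_ge) (simp add: A_def spectrum_def)
  also have "\<dots> = (\<Sum>z\<in>A \<times> A. cmod (gsum (fst z - snd z)))"
    by (simp add: sum.cartesian_product case_prod_unfold)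
  also have "\<dots> = (\<Sum>z\<in>A \<times> A - E. cmod (gsum (fst z - snd z))) + (\<Sum>z\<in>E. cmod (gsum (fst z - snd z)))"
    using finA EA by (intro sum.subset_diff) auto
  also have "(\<Sum>z\<in>E. cmod (gsum (fst z - snd z))) \<le> (\<Sum>z\<in>E. 1)"
    using EA AF by (intro sum_mono cmod_gsum_le_1 diff_mem) auto
  also have "(\<Sum>z\<in>A \<times> A - E. cmod (gsum (fst z - snd z))) \<le> (\<Sum>z\<in>A \<times> A - E. t^2/2)"
    using AF by (intro sum_mono) (auto simp: E_def spectrum_def subset_iff diff_mem)
  also have "(\<Sum>z\<in>A \<times> A - E. t^2/2) \<le> (\<Sum>z\<in>A \<times> A. t^2/2)"
    using finA by (intro sum_mono2) auto
  finally have "t^2 * real (card A)^2 \<le> real (card A)^2 * (t^2/2) + real (card E)"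
    by (simp add: card_cartesian_product power2_eq_square)
  then show ?thesis by (simp add: E_def mult.commute)
qed

text \<open>Fourier inversion counts the triples with a h + i - j = 0, of which there are none. The
  zero frequency contributes |I|^2 and has to be cancelled by the others, whose weights add up to
  only |F| |I| - |I|^2 by Parseval; so one of the nonzero frequencies carries a large sum.\<close>

lemma large_gsum_if_coset_avoids_differences:
  assumes I: "I \<subseteq> F" and a: "a \<in> F" "a \<noteq> 0"
    and avoid: "\<And>i j h. i \<in> I \<Longrightarrow> j \<in> I \<Longrightarrow> h \<in> H \<Longrightarrow> i - j \<noteq> a * h"
  shows "\<exists>m\<in>F. m \<noteq> 0 \<and> real (card I) / real (card F) \<le> cmod (gsum m)"
proof (cases "I = {}")
  case True
  then show ?thesis using unit_mem unit_neq_0 by auto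
next
  case False
  have finI: "finite I" using I finF finite_subset by blast
  define p where "p = real (card F)"
  define N where "N = real (card I)"
  define J where "J m = (\<Sum>i\<in>I. \<chi> (m * i))" for m
  have Npos: "N > 0" using False finI by (simp add: N_def card_gt_0_iff)
  have ppos: "p > 0" using finF zero_mem by (auto simp: p_def card_gt_0_iff)
  have n0: "of_nat (card H) \<noteq> (0::complex)" using cardH_pos by simp
  have J0: "J 0 = of_real N" by (simp add: J_def N_def char_0)
  have "(\<Sum>m\<in>F. of_nat (card H) * gsum (m * a) * (J m * cnj (J m))) = 0"
  proof -
    have "(\<Sum>m\<in>F. of_nat (card H) * gsum (m * a) * (J m * cnj (J m))) =
        (\<Sum>m\<in>F. \<Sum>h\<in>H. \<Sum>i\<in>I. \<Sum>j\<in>I. \<chi> (m * (a * h + (i - j))))"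
    proof (intro sum.cong refl)
      fix m assume m: "m \<in> F"
      have "\<chi> (h * (m * a)) * (\<chi> (m * i) * cnj (\<chi> (m * j))) = \<chi> (m * (a * h + (i - j)))"
        if "h \<in> H" "i \<in> I" "j \<in> I" for h i j
      proof -
        have F: "h \<in> F" "i \<in> F" "j \<in> F" using that HF I by auto
        have "m * (a * h + (i - j)) = h * (m * a) + (m * i - m * j)" by (simp add: algebra_simps)
        then show ?thesis using F m a by (simp add: char_add char_diff mult_mem diff_mem)
      qed
      then have "\<chi> (h * (m * a)) * (J m * cnj (J m)) = (\<Sum>i\<in>I. \<Sum>j\<in>I. \<chi> (m * (a * h + (i - j))))" if "h \<in> H" for h
        unfolding J_def cnj_sum sum_product using that by (simp add: sum_distrib_left)
      then have "(\<Sum>h\<in>H. \<chi> (h * (m * a))) * (J m * cnj (J m)) = (\<Sum>h\<in>H. \<Sum>i\<in>I. \<Sum>j\<in>I. \<chi> (m * (a * h + (i - j))))"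
        by (simp add: sum_distrib_right)
      then show "of_nat (card H) * gsum (m * a) * (J m * cnj (J m)) =
          (\<Sum>h\<in>H. \<Sum>i\<in>I. \<Sum>j\<in>I. \<chi> (m * (a * h + (i - j))))"
        using n0 by (simp add: gsum_def)
    qed
    also have "\<dots> = (\<Sum>h\<in>H. \<Sum>m\<in>F. \<Sum>i\<in>I. \<Sum>j\<in>I. \<chi> (m * (a * h + (i - j))))" by (rule sum.swap)
    also have "\<dots> = (\<Sum>h\<in>H. \<Sum>i\<in>I. \<Sum>m\<in>F. \<Sum>j\<in>I. \<chi> (m * (a * h + (i - j))))" by (intro sum.cong refl sum.swap)
    also have "\<dots> = (\<Sum>h\<in>H. \<Sum>i\<in>I. \<Sum>j\<in>I. \<Sum>m\<in>F. \<chi> (m * (a * h + (i - j))))" by (intro sum.cong refl sum.swap)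
    also have "\<dots> = (\<Sum>h\<in>H. \<Sum>i\<in>I. \<Sum>j\<in>I. 0)"
    proof (intro sum.cong refl)
      fix h i j assume hij: "h \<in> H" "i \<in> I" "j \<in> I"
      have "a * h + (i - j) \<in> F" using hij HF I a by (intro add_mem mult_mem diff_mem) auto
      \<comment> \<open>\<open>avoid\<close> is applied with i and j exchanged: vanishing would mean
        j - i = a h.\<close>
      moreover have "a * h + (i - j) \<noteq> 0"
        using avoid[OF hij(3,2,1)] by (metis add.commute add_diff_cancel_left' diff_0 minus_diff_eq add.inverse_inverse)
      ultimately show "(\<Sum>m\<in>F. \<chi> (m * (a * h + (i - j)))) = 0" by (rule char_orth)
    qed
    finally show ?thesis by simp
  qed
  moreover have "of_nat (card H) * gsum (m * a) * (J m * cnj (J m)) =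
      of_nat (card H) * (gsum (m * a) * of_real (cmod (J m) ^ 2))" for m
    by (simp add: complex_norm_square[symmetric] mult.assoc)
  ultimately have zero: "(\<Sum>m\<in>F. gsum (m * a) * of_real (cmod (J m) ^ 2)) = 0"
    using n0 by (simp flip: sum_distrib_left)
  have parJ: "(\<Sum>m\<in>F - {0}. cmod (J m) ^ 2) = p * N - N^2"
    using parseval_set[OF I] finF zero_mem J0
    by (subst (asm) sum.remove[of F 0]) (auto simp: J_def[symmetric] p_def N_def char_0)
  have "gsum (0 * a) * of_real (cmod (J 0) ^ 2) = - (\<Sum>m\<in>F - {0}. gsum (m * a) * of_real (cmod (J m) ^ 2))"
    using zero finF zero_mem by (subst (asm) sum.remove[of F 0]) (auto simp: add_eq_0_iff2)
  then have "complex_of_real (N^2) = - (\<Sum>m\<in>F - {0}. gsum (m * a) * of_real (cmod (J m) ^ 2))"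
    using J0 Npos by (simp add: gsum_0)
  then have N2: "N^2 = cmod (\<Sum>m\<in>F - {0}. gsum (m * a) * of_real (cmod (J m) ^ 2))"
    by (metis norm_minus_cancel norm_of_real abs_of_nonneg zero_le_power2)
  show ?thesis
  proof (rule ccontr)
    assume "\<not> ?thesis"
    then have small: "cmod (gsum m) < N / p" if "m \<in> F" "m \<noteq> 0" for m
      using that by (auto simp: N_def p_def not_le)
    have "N^2 \<le> (\<Sum>m\<in>F - {0}. N / p * cmod (J m) ^ 2)"
      unfolding N2
    proof (intro order_trans[OF norm_sum] sum_mono)
      fix m assume m: "m \<in> F - {0}"
      then have "m * a \<in> F" "m * a \<noteq> 0" using a mult_mem mult_eq_0_mem by auto
      then have "cmod (gsum (m * a)) \<le> N / p" using small by (simp add: less_imp_le)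
      then have "cmod (gsum (m * a)) * cmod (J m) ^ 2 \<le> N / p * cmod (J m) ^ 2"
        by (rule mult_right_mono) simp
      then show "cmod (gsum (m * a) * of_real (cmod (J m) ^ 2)) \<le> N / p * cmod (J m) ^ 2"
        by (simp add: norm_mult norm_power)
    qed
    also have "\<dots> = N / p * (p * N - N^2)" by (simp only: sum_distrib_left[symmetric] parJ)
    also have "\<dots> = N^2 - N^3 / p" using ppos by (simp add: field_simps power2_eq_square power3_eq_cube)
    finally have "N^3 / p \<le> 0" by simp
    then show False using Npos ppos by (simp add: divide_le_0_iff)
  qed
qed

end

section \<open>Choice of a scale and the bound for the exponential sums\<close>

text \<open>Pigeonhole over scales: if every step multiplied f by more than z, then f J would exceed
  z^J.\<close>

lemma ex_slow_growth_step:
  fixes f :: "nat \<Rightarrow> real"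
  assumes "0 < J" "1 \<le> f 0" "f J \<le> z ^ J" "0 < z"
  shows "\<exists>j<J. f (Suc j) \<le> z * f j"
proof (rule ccontr)
  assume "\<not> ?thesis"
  then have *: "z * f j < f (Suc j)" if "j < J" for j using that by (auto simp: not_le)
  have ge: "z ^ j \<le> f j" if "j \<le> J" for j
    using that
  proof (induction j)
    case (Suc j)
    then have "z * z ^ j \<le> z * f j" using assms by (intro mult_left_mono) auto
    then show ?case using *[of j] Suc.prems by simp
  qed (use assms in simp)
  obtain j where j: "J = Suc j" using assms(1) gr0_implies_Suc by blast
  have "z ^ J = z * z ^ j" by (simp add: j)
  also have "\<dots> \<le> z * f j" using ge[of j] assms by (intro mult_left_mono) (auto simp: j)
  also have "\<dots> < f J" using *[of j] by (simp add: j)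
  finally show False using assms by simp
qed

context subgroup_character
begin

text \<open>The spectra at the scales 0 to J have between 1 and |F| = z^J elements, so one of the J
  steps enlarges the spectrum by a factor of at most z. All losses at that step are powers of
  \<open>z\<close>, numerical constants being absorbed by 2 \<le> z.\<close>

lemma spectrum_approx_group:
  fixes z \<tau> :: real and J :: nat
  assumes z: "2 \<le> z" and J: "0 < J" "z ^ J = real (card F)"
    and \<tau>: "0 < \<tau>" "1 / z \<le> \<tau> ^ (2 ^ J)"
    and m: "m \<in> F" "m \<noteq> 0" "2 * \<tau> \<le> cmod (gsum m)"
  shows "\<exists>V B M. M \<le> z ^ 270 \<and> approx_group_in_field F e V M \<and> B \<subseteq> H \<and>
    real (card H) / z ^ 4 \<le> real (card B) \<and> (\<forall>b\<in>B. approx_group_in_field.good V M b) \<and>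
    real (card H) / z ^ 8 \<le> real (card V) \<and> real (card V) \<le> z ^ 272 * real (card F) / real (card H)"
proof -
  \<comment> \<open>The solution of t (j + 1) = (t j)^2 / 2 that starts at 2 \<tau>.\<close>
  define t where "t j = 2 * \<tau> ^ (2 ^ j)" for j :: nat
  have \<tau>1: "\<tau> \<le> 1" using m(3) cmod_gsum_le_1[OF m(1)] \<tau> by linarith
  have tSuc: "t (Suc j) = (t j)^2 / 2" for j
    by (simp add: t_def power_mult_distrib power_mult[symmetric] mult.commute)
  have tpos: "0 < t j" for j using \<tau> by (simp add: t_def)
  have tz: "1 / z \<le> t j" if "j \<le> J" for j
  proof -
    have "\<tau> ^ (2 ^ J) \<le> \<tau> ^ (2 ^ j)" using \<tau>1 \<tau> that by (auto intro!: power_decreasing[of "2^j" "2^J"])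
    then show ?thesis using \<tau>(2) zero_less_power[OF \<tau>(1), of "2^j"] unfolding t_def by linarith
  qed
  have t0: "t j \<le> 2 * \<tau>" for j
    unfolding t_def using power_decreasing[of 1 "2^j" \<tau>] \<tau> \<tau>1 by simp
  have mS: "m \<in> spectrum (t j)" for j using m t0[of j] by (simp add: spectrum_def)
  have nle: "card H \<le> card (spectrum (t j))" for j using card_H_le_spectrum[OF mS m(2)] .
  have "\<exists>j<J. real (card (spectrum (t (Suc j)))) \<le> z * real (card (spectrum (t j)))"
  proof (rule ex_slow_growth_step)
    show "1 \<le> real (card (spectrum (t 0)))" using nle[of 0] cardH_pos by linarith
    have "card (spectrum (t J)) \<le> card F" using finF spectrum_subset by (rule card_mono)
    then show "real (card (spectrum (t J))) \<le> z ^ J" using J by simp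
  qed (use J z in auto)
  \<comment> \<open>At this scale the spectrum barely grows, so that its differences often stay in a set of comparable size.\<close>
  then obtain j where j: "j < J" "real (card (spectrum (t (Suc j)))) \<le> z * real (card (spectrum (t j)))" by blast
  define A where "A = spectrum (t j)"
  define n where "n = real (card H)"
  have npos: "n > 0" using cardH_pos by (simp add: n_def)
  have AF: "A \<subseteq> F" and finA: "finite A" and Ane: "A \<noteq> {}"
    using spectrum_subset finite_spectrum mS[of j] by (auto simp: A_def)
  have An: "n \<le> real (card A)" using nle[of j] by (simp add: A_def n_def)
  have Ap: "real (card A) \<le> z^2 * real (card F) / n"
  proof -
    have "real (card A) * (1/z)^2 \<le> real (card A) * (t j)^2"
      using tz[of j] j z by (intro mult_left_mono power_mono) auto
    also have "\<dots> \<le> real (card F) / n"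
      using card_spectrum_le[of "t j"] tpos[of j] by (simp add: A_def n_def)
    finally show ?thesis using z npos by (simp add: field_simps)
  qed
  define E where "E = {w \<in> A \<times> A. fst w - snd w \<in> spectrum (t (Suc j))}"
  have dens: "1 / z * real (card A)^2 \<le> real (card E)"
  proof -
    have "1 / z * real (card A)^2 \<le> t (Suc j) * real (card A)^2"
      using tz[of "Suc j"] j by (intro mult_right_mono) auto
    also have "\<dots> \<le> real (card E)"
      using spectrum_many_differences[of "t j"] tpos[of j] by (simp add: A_def E_def tSuc)
    finally show ?thesis .
  qed
  have "\<exists>A' \<subseteq> A. 1 / z / 4 * real (card A) \<le> real (card A') \<and>
     real (card (A' + uminus ` A')) * (1/z)^5 \<le> 1024 * z^4 * real (card A)"
  proof (rule balog_szemeredi_gowers[OF finA Ane, of "spectrum (t (Suc j))" E])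
    show "a - b \<in> spectrum (t (Suc j))" if "(a, b) \<in> E" for a b using that by (simp add: E_def)
  qed (use j dens z finite_spectrum in \<open>auto simp: A_def E_def\<close>)
  then obtain A' where A': "A' \<subseteq> A" "1 / z / 4 * real (card A) \<le> real (card A')"
     "real (card (A' + uminus ` A')) * (1/z)^5 \<le> 1024 * z^4 * real (card A)" by blast
  \<comment> \<open>Density 1/z and growth z in the Balog-Szemeredi-Gowers theorem leave a
    proportion 1/(4 z) of \<open>A\<close>, with doubling constant 1024 z^4 * 4 z * z^5.\<close>
  define \<beta> where "\<beta> = 1 / (4 * z)"
  define K where "K = 4096 * z^10"
  have "0 < 1 / z / 4 * real (card A)" using An npos z by simp
  then have A'ne: "A' \<noteq> {}" using A'(2) by auto
  have \<beta>: "0 < \<beta>" "\<beta> * real (card A) \<le> real (card A')" using z A'(2) by (auto simp: \<beta>_def)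
  have "real (card A) \<le> 4 * z * real (card A')" using A'(2) z by (simp add: field_simps)
  then have "1024 * z^4 * real (card A) \<le> 1024 * z^4 * (4 * z * real (card A'))"
    using z by (intro mult_left_mono) auto
  with A'(3) have "real (card (A' + uminus ` A')) * (1/z)^5 \<le> 1024 * z^4 * (4 * z * real (card A'))" by linarith
  then have "real (card (A' + uminus ` A')) * (1/z)^5 * z^5 \<le> 1024 * z^4 * (4 * z * real (card A')) * z^5"
    using z by (intro mult_right_mono) auto
  then have K: "real (card (A' + uminus ` A')) \<le> K * real (card A')"
    using z by (simp add: K_def power_divide eval_nat_numeral ac_simps)
  define \<rho> where "\<rho> = \<beta> / 2"
  define M where "M = (2 * K^2 / \<rho>^2)^5 * (2 / \<rho>)"
  obtain V B where VB: "approx_group_in_field F e V M" "B \<subseteq> H" "\<rho> * real (card H) \<le> real (card B)"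
    "\<forall>b\<in>B. approx_group_in_field.good V M b"
    "\<rho>/2 * real (card A') \<le> real (card V)" "real (card V) \<le> M * real (card A')"
    using exists_approx_group[OF AF _ A'(1) A'ne \<beta> K] spectrum_mult_H unfolding M_def \<rho>_def A_def by blast
  have two: "(2::real) ^ k \<le> z ^ k" for k using z by (intro power_mono) auto
  \<comment> \<open>Here \<open>K\<close> is 2^12 z^10 and \<open>\<rho>\<close> is 1/(8 z). This
    makes \<open>M\<close> equal to 2^159 z^111, and the power of two is absorbed into
    z^159.\<close>
  have q: "2 * K^2 / \<rho>^2 = 2^31 * z^22"
    using z by (simp add: K_def \<rho>_def \<beta>_def power_mult_distrib power_divide field_simps flip: power_mult power_add)
  have "M = (2^31 * z^22)^5 * (2^4 * z)" unfolding M_def q using z by (simp add: \<rho>_def \<beta>_def)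
  also have "\<dots> = (2^31)^5 * 2^4 * ((z^22)^5 * z)" by (simp only: power_mult_distrib ac_simps)
  also have "\<dots> = 2^159 * z^111"
    by (simp only: power_mult[symmetric] power_add[symmetric] power_Suc2[symmetric]) simp
  also have "\<dots> \<le> z^159 * z^111" by (rule mult_right_mono[OF two]) (use z in auto)
  finally have M: "M \<le> z^270" by (simp flip: power_add)
  have "n / z^4 \<le> \<rho> * n"
    using two[of 3] z npos by (simp add: \<rho>_def \<beta>_def field_simps eval_nat_numeral)
  then have cB: "n / z^4 \<le> real (card B)" using VB(3) by (simp add: n_def)
  have cA': "\<beta> * n \<le> real (card A')" using \<beta> An mult_left_mono[OF An, of \<beta>] by linarith
  have "n / z^8 \<le> \<rho>/2 * (\<beta> * n)"
  proof -
    have "n * (64 * z^2) \<le> n * z^8" using two[of 6] z npos by (simp add: eval_nat_numeral)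
    then show ?thesis using z by (simp add: \<rho>_def \<beta>_def field_simps power2_eq_square)
  qed
  also have "\<dots> \<le> \<rho>/2 * real (card A')" using cA' \<beta> by (intro mult_left_mono) (auto simp: \<rho>_def)
  finally have cV: "n / z^8 \<le> real (card V)" using VB(5) by linarith
  have "card A' \<le> card A" using A'(1) finA by (simp add: card_mono)
  have "real (card V) \<le> z^270 * real (card A')"
    using VB(6) M mult_right_mono[OF M, of "real (card A')"] by simp
  also have "\<dots> \<le> z^270 * (z^2 * real (card F) / n)"
    using z Ap \<open>card A' \<le> card A\<close> by (intro mult_left_mono) auto
  also have "\<dots> = z^272 * real (card F) / n" by (simp flip: power_add mult.assoc)
  finally have cV2: "real (card V) \<le> z^272 * real (card F) / n" .
  show ?thesis using M VB cB cV cV2 unfolding n_def by blast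
qed

text \<open>A large sum would yield an approximate group \<open>V\<close> with at least |H| / z^4
  good multipliers. By growth all of \<open>F\<close> is good, so the double count forces |V| up to
  |F| apart from a power of z. The Parseval bound on |V| excludes this, as |H| is a larger power of
  z.\<close>

theorem gsum_small:
  fixes z \<tau> :: real and i J :: nat
  assumes z: "2 \<le> z" and J: "0 < J" "z ^ J = real (card F)"
    and \<tau>: "0 < \<tau>" "1 / z \<le> \<tau> ^ (2 ^ J)"
    and n: "z ^ (4320 * 13 ^ i + 600) \<le> real (card H)"
    and ni: "real (card F) < (real (card H) / z ^ 4) ^ (2 ^ i)"
    and m: "m \<in> F" "m \<noteq> 0"
  shows "cmod (gsum m) < 2 * \<tau>"
proof (rule ccontr)
  assume "\<not> ?thesis"
  then have "2 * \<tau> \<le> cmod (gsum m)" by simp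
  from spectrum_approx_group[OF z J \<tau> m this] obtain V B M where
    M: "M \<le> z ^ 270" and ag: "approx_group_in_field F e V M" and BH: "B \<subseteq> H"
    and cB: "real (card H) / z ^ 4 \<le> real (card B)" and gB: "\<forall>b\<in>B. approx_group_in_field.good V M b"
    and cV: "real (card H) / z ^ 8 \<le> real (card V)" "real (card V) \<le> z ^ 272 * real (card F) / real (card H)"
    by blast
  interpret V: approx_group_in_field F e V M by (rule ag)
  \<comment> \<open>Growth turns z^270 into z^(270 * 8 * 13^i). The assumed size of |H| provides
    twice this exponent, since \<open>L\<close> enters squared, and 600 more for the remaining
    losses.\<close>
  define N :: nat where "N = 2160 * 13 ^ i"
  define nn where "nn = real (card H)"
  define p where "p = real (card F)"
  have M1: "1 \<le> M" by (rule V.K_ge_1)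
  have npos: "nn > 0" using cardH_pos by (simp add: nn_def)
  have nz: "z ^ (2 * N + 600) \<le> nn" using n by (simp add: N_def nn_def)
  have nk: "z ^ k \<le> nn" if "k \<le> 2 * N + 600" for k
    using power_increasing[OF that, of z] z nz by linarith
  have B2: "2 \<le> card B"
  proof -
    have "2 * z^4 \<le> z^5" using z by (simp add: eval_nat_numeral)
    also have "\<dots> \<le> nn" by (rule nk) simp
    finally have "2 \<le> nn / z^4" using z by (simp add: field_simps)
    then show ?thesis using cB by (simp add: nn_def)
  qed
  have "p < real (card B) ^ (2 ^ i)"
    using ni power_mono[OF cB, of "2^i"] z unfolding p_def by (smt (verit) divide_nonneg_nonneg of_nat_0_le_iff zero_le_power)
  then have cF: "card F < card B ^ (2 ^ i)" unfolding p_def by (metis of_nat_less_iff of_nat_power)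
  define L where "L = M ^ (8 * 13 ^ i)"
  have all: "V.good L x" if "x \<in> F" for x
    unfolding L_def using BH HF B2 gB cF that by (intro V.good_growth[of B]) auto
  have L1: "0 \<le> L" using M1 by (simp add: L_def)
  have "L \<le> (z ^ 270) ^ (8 * 13 ^ i)" unfolding L_def using M M1 by (intro power_mono) auto
  also have "\<dots> = z ^ N" by (simp add: N_def flip: power_mult)
  finally have "L^2 \<le> (z ^ N)^2" using L1 by (intro power_mono) auto
  then have L2: "L^2 \<le> z ^ (2 * N)" by (simp add: power_mult[symmetric] mult.commute)
  have twoL: "2 * L^2 \<le> z ^ (2 * N + 1)"
    using mult_mono[OF z L2] z by simp
  have "2 * L^2 \<le> real (card V)"
  proof -
    have "z ^ (2 * N + 1) * z ^ 8 = z ^ (2 * N + 9)" by (simp only: power_add[symmetric]) (simp add: add.commute)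
    then have "z ^ (2 * N + 1) * z ^ 8 \<le> nn" using nk[of "2 * N + 9"] by simp
    then have "z ^ (2 * N + 1) \<le> nn / z ^ 8" using z by (simp add: field_simps)
    then show ?thesis using twoL cV by (simp add: nn_def)
  qed
  from V.all_good_size_bound[OF all this] have "p - 1 \<le> 2 * L^2 * M * real (card V)" by (simp add: p_def)
  also have "\<dots> \<le> z ^ (2 * N + 1) * z ^ 270 * (z ^ 272 * p / nn)"
    using twoL M cV(2) z M1 by (intro mult_mono) (auto simp: p_def nn_def)
  also have "z ^ (2 * N + 1) * z ^ 270 * (z ^ 272 * p / nn) = z ^ ((2 * N + 1) + 270 + 272) * p / nn"
    by (simp only: power_add times_divide_eq_right mult.assoc)
  also have "(2 * N + 1) + 270 + 272 = 2 * N + 543" by simp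
  also have "z ^ (2 * N + 543) * p / nn \<le> p / 2"
  proof -
    have "2 * z ^ (2 * N + 543) \<le> z * z ^ (2 * N + 543)" using z by (intro mult_right_mono) auto
    also have "\<dots> = z ^ Suc (2 * N + 543)" by (simp only: power_Suc)
    also have "Suc (2 * N + 543) = 2 * N + 544" by simp
    also have "z ^ (2 * N + 544) \<le> nn" by (rule nk) simp
    finally have "2 * z ^ (2 * N + 543) * p \<le> nn * p" by (intro mult_right_mono) (auto simp: p_def)
    then show ?thesis using npos by (simp add: field_simps)
  qed
  \<comment> \<open>Impossible, because 4 \<le> z^2 \<le> |H| \<le> p.\<close>
  finally have "p \<le> 2" by simp
  moreover have "nn \<le> p" using card_mono[OF finF HF] by (simp add: p_def nn_def)
  moreover have "z^2 \<le> nn" by (rule nk) simp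
  moreover have "4 \<le> z^2" using power_mono[OF z, of 2] by simp
  ultimately show False by linarith
qed

end

section \<open>Prime fields and power residues\<close>

text \<open>
  The ring \<open>\<Prod>\<^sub>q \<int>/q\<int>\<close>, which contains a copy of every prime field, so that the
  modulus can remain a variable of the theorem rather than a parameter of a type.
\<close>

typedef residue_family = "{f :: nat \<Rightarrow> int. \<forall>q. f q mod int q = f q}"
  morphisms residue_at Abs_residue_family
  by (rule exI[of _ "\<lambda>_. 0"]) simp

setup_lifting type_definition_residue_family

instantiation residue_family :: comm_ring_1
begin

lift_definition zero_residue_family :: residue_family is "\<lambda>_. 0" by simp
lift_definition one_residue_family :: residue_family is "\<lambda>q. 1 mod int q" by simp
lift_definition plus_residue_family :: "residue_family \<Rightarrow> residue_family \<Rightarrow> residue_family"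
  is "\<lambda>f g q. (f q + g q) mod int q" by simp
lift_definition minus_residue_family :: "residue_family \<Rightarrow> residue_family \<Rightarrow> residue_family"
  is "\<lambda>f g q. (f q - g q) mod int q" by simp
lift_definition uminus_residue_family :: "residue_family \<Rightarrow> residue_family"
  is "\<lambda>f q. (- f q) mod int q" by simp
lift_definition times_residue_family :: "residue_family \<Rightarrow> residue_family \<Rightarrow> residue_family"
  is "\<lambda>f g q. (f q * g q) mod int q" by simp

instance
proof
  fix a b c :: residue_family
  show "a * b * c = a * (b * c)" by transfer (simp add: mod_simps mult.assoc)
  show "a * b = b * a" by transfer (simp add: mult.commute)
  show "1 * a = a" by transfer (simp add: mod_simps)
  show "a + b + c = a + (b + c)" by transfer (simp add: mod_simps add.assoc)
  show "a + b = b + a" by transfer (simp add: add.commute)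
  show "0 + a = a" by transfer simp
  show "- a + a = 0" by transfer (simp add: mod_simps)
  show "a - b = a + - b" by transfer (simp add: mod_simps)
  show "(a + b) * c = a * c + b * c" by transfer (simp add: mod_simps distrib_right)
  \<comment> \<open>Compared at coordinate 0, where reduction \<open>mod 0\<close> is the identity
    and 1 stays 1.\<close>
  show "(0::residue_family) \<noteq> 1" by transfer (auto dest: fun_cong[of _ _ 0])
qed

end

section \<open>The embedded copy of the integers modulo p\<close>

text \<open>All coordinates other than p are 0, so the map respects sums and products but sends 1 to
  an idempotent different from the unit of the ring.\<close>

lift_definition embed_residue :: "nat \<Rightarrow> int \<Rightarrow> residue_family"
  is "\<lambda>p a q. if q = p then a mod int p else 0" by simp

lemma residue_at_embed: "residue_at (embed_residue p a) p = a mod int p"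
  by transfer simp

lemma embed_residue_eq_iff: "embed_residue p a = embed_residue p b \<longleftrightarrow> [a = b] (mod int p)"
  by transfer (auto simp: fun_eq_iff cong_def)

lemma embed_residue_add: "embed_residue p a + embed_residue p b = embed_residue p (a + b)"
  by transfer (auto simp: fun_eq_iff mod_simps)

lemma embed_residue_diff: "embed_residue p a - embed_residue p b = embed_residue p (a - b)"
  by transfer (auto simp: fun_eq_iff mod_simps)

lemma embed_residue_uminus: "- embed_residue p a = embed_residue p (- a)"
  by transfer (auto simp: fun_eq_iff mod_simps)

lemma embed_residue_mult: "embed_residue p a * embed_residue p b = embed_residue p (a * b)"
  by transfer (auto simp: fun_eq_iff mod_simps)

lemma embed_residue_0: "embed_residue p 0 = 0"
  by transfer (auto simp: fun_eq_iff)

lemma embed_residue_eq_0_iff: "embed_residue p a = 0 \<longleftrightarrow> [a = 0] (mod int p)"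
  using embed_residue_eq_iff[of p a 0] by (simp add: embed_residue_0)

lemma range_embed_residue:
  assumes "0 < p" shows "range (embed_residue p) = embed_residue p ` {0..<int p}"
proof -
  have "embed_residue p a \<in> embed_residue p ` {0..<int p}" for a
    using assms by (intro image_eqI[of _ _ "a mod int p"]) (auto simp: embed_residue_eq_iff)
  then show ?thesis by blast
qed

lemma inj_on_embed_residue: "X \<subseteq> {0..<int p} \<Longrightarrow> inj_on (embed_residue p) X"
  by (auto simp: inj_on_def embed_residue_eq_iff cong_def subset_iff)

lemma card_range_embed_residue: "0 < p \<Longrightarrow> card (range (embed_residue p)) = p"
  by (simp add: range_embed_residue card_image inj_on_embed_residue)

lemma prime_field_in_ring_embed:
  assumes "prime p"
  shows "prime_field_in_ring (range (embed_residue p)) (embed_residue p 1)"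
proof
  have p: "0 < p" "1 < p" using assms prime_gt_0_nat prime_gt_1_nat by auto
  show "finite (range (embed_residue p))" using p by (simp add: range_embed_residue)
  show "embed_residue p 1 \<noteq> 0" using p by (simp add: embed_residue_eq_0_iff cong_def)
  fix x assume "x \<in> range (embed_residue p)" and x0: "x \<noteq> 0"
  then obtain a where a: "x = embed_residue p a" by blast
  have "\<not> int p dvd a" using x0 by (simp add: a embed_residue_eq_0_iff cong_0_iff)
  then have "coprime a (int p)"
    using assms prime_imp_coprime[of "int p" a] by (simp add: coprime_commute)
  then obtain b where "[a * b = 1] (mod int p)" using cong_solve_coprime_int by blast
  then have "x * embed_residue p b = embed_residue p 1"
    by (simp add: a embed_residue_mult embed_residue_eq_iff)
  then show "\<exists>y\<in>range (embed_residue p). x * y = embed_residue p 1" by blast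
next
  have p: "0 < p" using assms prime_gt_0_nat by auto
  fix Q :: "residue_family set" assume Q: "0 \<in> Q" "\<And>x. x \<in> Q \<Longrightarrow> x + embed_residue p 1 \<in> Q"
  have nat: "embed_residue p (int k) \<in> Q" for k :: nat
  proof (induction k)
    case (Suc k)
    then show ?case using Q(2)[OF Suc] by (simp add: embed_residue_add add.commute)
  qed (use Q in \<open>simp add: embed_residue_0\<close>)
  show "range (embed_residue p) \<subseteq> Q"
  proof (unfold range_embed_residue[OF p], clarify)
    fix a :: int assume "a \<in> {0..<int p}"
    then show "embed_residue p a \<in> Q" using nat[of "nat a"] by simp
  qed
qed (auto simp: embed_residue_add embed_residue_uminus embed_residue_mult)

section \<open>Additive characters modulo p\<close>

lemma cis_int_mod:
  assumes "0 < p" shows "cis (2 * pi * real_of_int (a mod int p) / real p) = cis (2 * pi * real_of_int a / real p)"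
proof -
  have "real_of_int a = real p * real_of_int (a div int p) + real_of_int (a mod int p)"
    by (metis mult_div_mod_eq of_int_add of_int_mult of_int_of_nat_eq)
  then have "2 * pi * real_of_int a / real p =
      2 * pi * real_of_int (a div int p) + 2 * pi * real_of_int (a mod int p) / real p"
    using assms by (simp add: field_simps)
  then show ?thesis by (simp flip: cis_mult)
qed

lemma cis_int_eq_1_imp_dvd:
  assumes "0 < p" "cis (2 * pi * real_of_int a / real p) = 1" shows "int p dvd a"
proof -
  have "cos (2 * pi * real_of_int a / real p) = 1" using assms(2) by (simp add: complex_eq_iff)
  then obtain k :: int where "2 * pi * real_of_int a / real p = real_of_int k * 2 * pi"
    by (auto simp: cos_one_2pi_int)
  then have "pi * real_of_int a = pi * (real_of_int k * real p)" using assms by (simp add: field_simps)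
  then have "real_of_int a = real_of_int (k * int p)" by simp
  then have "a = k * int p" by (simp only: of_int_eq_iff)
  then show ?thesis by simp
qed

definition residue_char :: "nat \<Rightarrow> residue_family \<Rightarrow> complex" where
  "residue_char p x = cis (2 * pi * real_of_int (residue_at x p) / real p)"

lemma residue_char_embed: "0 < p \<Longrightarrow> residue_char p (embed_residue p a) = cis (2 * pi * real_of_int a / real p)"
  by (simp add: residue_char_def residue_at_embed cis_int_mod)

lemma residue_char_add:
  assumes "0 < p" "x \<in> range (embed_residue p)" "y \<in> range (embed_residue p)"
  shows "residue_char p (x + y) = residue_char p x * residue_char p y"
  using assms by (auto simp: embed_residue_add residue_char_embed cis_mult add_divide_distrib distrib_left)

text \<open>Shifting the summation variable by the unit multiplies the sum by the value of the
  character at y, which is not 1.\<close>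

lemma residue_char_orth:
  assumes p: "prime p" and y: "y \<in> range (embed_residue p)" "y \<noteq> 0"
  shows "(\<Sum>x\<in>range (embed_residue p). residue_char p (x * y)) = 0"
proof -
  have p0: "0 < p" using p prime_gt_0_nat by auto
  interpret prime_field_in_ring "range (embed_residue p)" "embed_residue p 1"
    by (rule prime_field_in_ring_embed[OF p])
  define S where "S = (\<Sum>x\<in>range (embed_residue p). residue_char p (x * y))"
  obtain b where b: "y = embed_residue p b" using y by blast
  have "S = (\<Sum>x\<in>range (embed_residue p). residue_char p ((x + embed_residue p 1) * y))"
    unfolding S_def
    by (rule sum.reindex_bij_witness[where i="\<lambda>x. x + embed_residue p 1" and j="\<lambda>x. x - embed_residue p 1"])
       (auto intro: add_mem diff_mem)
  also have "\<dots> = (\<Sum>x\<in>range (embed_residue p). residue_char p (x * y) * residue_char p y)"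
    using y by (intro sum.cong refl) (simp add: distrib_right unit_mult residue_char_add[OF p0] mult_mem)
  also have "\<dots> = S * residue_char p y" by (simp add: S_def sum_distrib_right)
  finally have "S = S * residue_char p y" .
  moreover have "residue_char p y \<noteq> 1"
    using cis_int_eq_1_imp_dvd[OF p0, of b] y(2) b p0
    by (auto simp: residue_char_embed embed_residue_eq_0_iff cong_0_iff)
  ultimately show ?thesis by (simp add: S_def)
qed

section \<open>The group of n-th roots of unity modulo p\<close>

text \<open>With a primitive root g and d = (p - 1)/n, the powers g^(j d) for j < n are distinct
  roots.\<close>

lemma card_roots_of_unity_ge:
  assumes p: "prime p" and n: "n dvd p - 1"
  shows "n \<le> card {x \<in> {0..<int p}. [x ^ n = 1] (mod int p)}"
proof -
  have p1: "1 < p" using p prime_gt_1_nat by auto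
  obtain g where g: "residue_primroot p g" using prime_primitive_root_exists[OF p1 p] by blast
  have bij: "bij_betw (\<lambda>i. g ^ i mod p) {..<p - 1} (totatives p)"
    using residue_primroot_is_generator[OF p1 g] p by (simp add: totient_prime)
  obtain d where d: "p - 1 = n * d" using n by blast
  have d0: "0 < d" "0 < n" using d p1 by (cases d; cases n; simp)+
  define f where "f j = int (g ^ (j * d) mod p)" for j
  have inj: "inj_on f {..<n}"
  proof (rule inj_onI)
    fix j k assume jk: "j \<in> {..<n}" "k \<in> {..<n}" "f j = f k"
    then have "g ^ (j * d) mod p = g ^ (k * d) mod p" by (simp add: f_def)
    moreover have "j * d \<in> {..<p - 1}" "k * d \<in> {..<p - 1}" using jk d d0 by auto
    ultimately have "j * d = k * d" using bij unfolding bij_betw_def inj_on_def by blast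
    then show "j = k" using d0 by simp
  qed
  have gp: "[g ^ (p - 1) = 1] (mod p)"
    using g p euler_theorem[of g p] by (auto simp: residue_primroot_def totient_prime coprime_commute)
  have "f j \<in> {x \<in> {0..<int p}. [x ^ n = 1] (mod int p)}" for j
  proof -
    have "[(g ^ (j * d) mod p) ^ n = (g ^ (p - 1)) ^ j] (mod p)"
      unfolding d by (simp add: cong_def power_mod mult.commute mult.left_commute flip: power_mult)
    also have "[(g ^ (p - 1)) ^ j = 1 ^ j] (mod p)" using gp by (rule cong_pow)
    finally have "[(g ^ (j * d) mod p) ^ n = 1] (mod p)" by simp
    then have "[int ((g ^ (j * d) mod p) ^ n) = int 1] (mod int p)" by (simp only: cong_int_iff)
    then show ?thesis using p1 by (simp add: f_def)
  qed
  then have "card {..<n} \<le> card {x \<in> {0..<int p}. [x ^ n = 1] (mod int p)}"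
    using inj by (intro card_inj_on_le[where f=f] finite_Collect_conjI disjI1) auto
  then show ?thesis by simp
qed

lemma subgroup_character_roots_of_unity:
  assumes p: "prime p" and n: "0 < n"
  shows "subgroup_character (range (embed_residue p)) (embed_residue p 1)
    (embed_residue p ` {x. [x ^ n = 1] (mod int p)}) (residue_char p)"
proof -
  have p0: "0 < p" "1 < p" using p prime_gt_0_nat prime_gt_1_nat by auto
  interpret prime_field_in_ring "range (embed_residue p)" "embed_residue p 1"
    by (rule prime_field_in_ring_embed[OF p])
  show ?thesis
  proof
    show "0 \<notin> embed_residue p ` {x. [x ^ n = 1] (mod int p)}"
    proof
      assume "0 \<in> embed_residue p ` {x. [x ^ n = 1] (mod int p)}"
      then obtain x where x: "[x ^ n = 1] (mod int p)" "embed_residue p x = 0" by force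
      then have "[x ^ n = 0 ^ n] (mod int p)" by (intro cong_pow) (simp add: embed_residue_eq_0_iff)
      then have "[1 = 0] (mod int p)" using x(1) n by (metis cong_sym cong_trans zero_power)
      then show False using p0 by (simp add: cong_def)
    qed
    fix g h assume "g \<in> embed_residue p ` {x. [x ^ n = 1] (mod int p)}" "h \<in> embed_residue p ` {x. [x ^ n = 1] (mod int p)}"
    then obtain x y where xy: "g = embed_residue p x" "h = embed_residue p y" "[x ^ n = 1] (mod int p)" "[y ^ n = 1] (mod int p)"
      by blast
    then have "[(x * y) ^ n = 1] (mod int p)" using cong_mult[OF xy(3,4)] by (simp add: power_mult_distrib)
    then show "g * h \<in> embed_residue p ` {x. [x ^ n = 1] (mod int p)}" by (auto simp: xy embed_residue_mult)
  next
    fix h assume "h \<in> embed_residue p ` {x. [x ^ n = 1] (mod int p)}"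
    then obtain x where x: "h = embed_residue p x" "[x ^ n = 1] (mod int p)" by blast
    \<comment> \<open>As x^n is 1 modulo p, the power x^(n - 1) is the inverse of x.\<close>
    have e: "x * x ^ (n - 1) = x ^ n" using n by (simp flip: power_Suc)
    have "[(x ^ n) ^ (n - 1) = 1 ^ (n - 1)] (mod int p)" using x(2) by (rule cong_pow)
    then have "[(x ^ (n - 1)) ^ n = 1] (mod int p)" by (simp add: mult.commute flip: power_mult)
    moreover have "h * embed_residue p (x ^ (n - 1)) = embed_residue p 1"
      using x e by (simp add: embed_residue_mult embed_residue_eq_iff)
    ultimately show "\<exists>h'\<in>embed_residue p ` {x. [x ^ n = 1] (mod int p)}. h * h' = embed_residue p 1" by blast
  next
    fix y assume "y \<in> range (embed_residue p)" "y \<noteq> 0"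
    then show "(\<Sum>x\<in>range (embed_residue p). residue_char p (x * y)) = 0" by (rule residue_char_orth[OF p])
  qed (auto simp: residue_char_add[OF p0(1)], auto simp: residue_char_def)
qed

section \<open>From exponential sums to the bound for k(p, n)\<close>

text \<open>Every element of the coset x0 H has the n-th power m that is missed, so [-k, k] avoids
  this coset. The differences of a shorter interval \<open>I\<close> then avoid it too, which forces
  a normalised sum of size at least |I| / p, whereas \<open>gsum_small\<close> keeps all of them
  below 2 \<tau>.\<close>

lemma not_covers_bound:
  fixes z \<tau> :: real and i J p n k :: nat
  assumes p: "prime p" and n: "0 < n" "n dvd p - 1"
    and z: "2 \<le> z" and J: "0 < J" "z ^ J = real p"
    and \<tau>: "0 < \<tau>" "1 / z \<le> \<tau> ^ (2 ^ J)"
    and nz: "z ^ (4320 * 13 ^ i + 600) \<le> real n"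
    and ni: "real p < (real n / z ^ 4) ^ (2 ^ i)"
    and k: "k < p" "\<not> covers_power_residues p n k"
  shows "real k \<le> 4 * \<tau> * real p"
proof -
  have p0: "0 < p" using p prime_gt_0_nat by auto
  define F where "F = range (embed_residue p)"
  define H where "H = embed_residue p ` {x. [x ^ n = 1] (mod int p)}"
  interpret subgroup_character F "embed_residue p 1" H "residue_char p"
    unfolding F_def H_def by (rule subgroup_character_roots_of_unity[OF p n(1)])
  have cF: "card F = p" unfolding F_def using p0 by (rule card_range_embed_residue)
  have "n \<le> card {x \<in> {0..<int p}. [x ^ n = 1] (mod int p)}" by (rule card_roots_of_unity_ge[OF p n(2)])
  also have "\<dots> = card (embed_residue p ` {x \<in> {0..<int p}. [x ^ n = 1] (mod int p)})"
    by (rule card_image[symmetric], rule inj_on_embed_residue) auto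
  also have "\<dots> \<le> card H" using finH by (intro card_mono) (auto simp: H_def)
  finally have nH: "real n \<le> real (card H)" by simp
  obtain m where m: "nonzero_power_residue p n m"
    and no: "\<And>x. x \<in> {- int k..-1} \<union> {1..int k} \<Longrightarrow> \<not> [x ^ n = m] (mod int p)"
    using k(2) by (auto simp: covers_power_residues_def)
  obtain x0 where m0: "\<not> [m = 0] (mod int p)" and x0: "[x0 ^ n = m] (mod int p)"
    using m by (auto simp: nonzero_power_residue_def)
  \<comment> \<open>The differences of {0..L} stay within [-k, k], and k \<le> 2 (L + 1) turns the
    bound 2 \<tau> p for L + 1 into 4 \<tau> p for k.\<close>
  define L where "L = k div 2"
  define I where "I = embed_residue p ` {0..int L}"
  define a where "a = embed_residue p x0"
  have "a \<noteq> 0"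
  proof
    assume "a = 0"
    then have "[x0 ^ n = 0 ^ n] (mod int p)" by (intro cong_pow) (simp add: a_def embed_residue_eq_0_iff)
    then have "[m = 0] (mod int p)" using x0 n(1) by (metis cong_sym cong_trans zero_power)
    then show False using m0 by simp
  qed
  have avoid: "i - j \<noteq> a * h" if i: "i \<in> I" and j: "j \<in> I" and h: "h \<in> H" for i j h
  proof
    assume eq: "i - j = a * h"
    obtain i' j' h' where ijh: "i = embed_residue p i'" "i' \<in> {0..int L}" "j = embed_residue p j'" "j' \<in> {0..int L}"
      "h = embed_residue p h'" "[h' ^ n = 1] (mod int p)" using i j h by (auto simp: I_def H_def)
    have "[i' - j' = x0 * h'] (mod int p)"
      using eq by (simp add: ijh a_def embed_residue_diff embed_residue_mult embed_residue_eq_iff)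
    then have "[(i' - j') ^ n = (x0 * h') ^ n] (mod int p)" by (rule cong_pow)
    also have "[(x0 * h') ^ n = m * 1] (mod int p)"
      unfolding power_mult_distrib using x0 ijh(6) by (rule cong_mult)
    finally have c: "[(i' - j') ^ n = m] (mod int p)" by simp
    have "i' - j' \<noteq> 0"
    proof
      assume "i' - j' = 0"
      then have "[0 = m] (mod int p)" using c n(1) by (simp add: zero_power)
      then show False using m0 by (simp add: cong_sym_eq)
    qed
    moreover have "int L \<le> int k" by (simp add: L_def)
    ultimately have "i' - j' \<in> {- int k..-1} \<union> {1..int k}" using ijh(2,4) by auto
    then show False using no c by blast
  qed
  have "real (card F) < (real (card H) / z ^ 4) ^ (2 ^ i)"
  proof -
    have "(real n / z ^ 4) ^ (2 ^ i) \<le> (real (card H) / z ^ 4) ^ (2 ^ i)"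
      using nH z by (intro power_mono divide_right_mono) auto
    then show ?thesis unfolding cF using ni by linarith
  qed
  then have small: "cmod (gsum x) < 2 * \<tau>" if "x \<in> F" "x \<noteq> 0" for x
    using gsum_small[OF z J(1) _ \<tau>, of i x] J(2) cF nz nH that by simp
  have "I \<subseteq> F" by (auto simp: I_def F_def)
  moreover have "a \<in> F" by (auto simp: a_def F_def)
  ultimately obtain x where "x \<in> F" "x \<noteq> 0" "real (card I) / real (card F) \<le> cmod (gsum x)"
    using large_gsum_if_coset_avoids_differences[OF _ _ \<open>a \<noteq> 0\<close> avoid, of I] by blast
  then have "real (card I) / real p < 2 * \<tau>" using small[of x] cF by simp
  moreover have "card I = L + 1"
  proof -
    have "{0..int L} \<subseteq> {0..<int p}" using k(1) by (auto simp: L_def)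
    then show ?thesis unfolding I_def using inj_on_embed_residue[of "{0..int L}" p] by (simp add: card_image)
  qed
  ultimately have "real L + 1 < 2 * \<tau> * real p" using p0 by (simp add: field_simps)
  moreover have "k \<le> 2 * (L + 1)" by (simp add: L_def)
  then have "real k \<le> real (2 * (L + 1))" by (rule of_nat_mono)
  ultimately show ?thesis by simp
qed

text \<open>\<open>i\<close> and \<open>J\<close> depend on \<epsilon> alone, while z = p^(1/J) and
  \<tau> = p^(-\<delta>). Covering fails just below the minimum, which gives 4 p^(1 - \<delta>)
  there; the remaining 1 raises the constant to 5.\<close>

lemma least_cover_bound:
  fixes \<epsilon> :: real
  assumes \<epsilon>: "0 < \<epsilon>"
  shows "\<exists>\<delta>>0. (\<exists>P::nat. \<forall>p n::nat. prime p \<and> P \<le> p \<and> 0 < n \<and> n dvd p - 1 \<and> real p powr \<epsilon> < real n \<longrightarrow>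
    real (least_cover p n) \<le> 5 * real p powr (1 - \<delta>))"
proof -
  \<comment> \<open>Ensures that p^(\<epsilon>/2) raised to the power 2^i exceeds p.\<close>
  obtain i :: nat where i: "2 / \<epsilon> < 2 ^ i" using real_arch_pow[of 2 "2/\<epsilon>"] by auto
  define N :: nat where "N = 4320 * 13 ^ i + 600"
  \<comment> \<open>Ensures z^N \<le> p^\<epsilon> < n for z = p^(1/J).\<close>
  obtain J :: nat where J: "real N / \<epsilon> < real J" using reals_Archimedean2 by blast
  have "0 < N" by (simp add: N_def)
  then have "0 < real N / \<epsilon>" using \<epsilon> by simp
  then have J0: "0 < J" using J by (cases J) auto
  have NJ: "real N / real J \<le> \<epsilon>" using J J0 \<epsilon> by (simp add: field_simps)
  \<comment> \<open>As \<open>N\<close> is at least 8, dividing n by z^4 costs at most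
    p^(\<epsilon>/2).\<close>
  have "4 / real J \<le> (real N / real J) / 2" using J0 by (simp add: N_def field_simps)
  also have "\<dots> \<le> \<epsilon> / 2" using NJ by (rule divide_right_mono) simp
  finally have four: "4 / real J \<le> \<epsilon> / 2" .
  \<comment> \<open>Chosen so that p^(-\<delta>) raised to the power 2^J is exactly 1/z.\<close>
  define \<delta> :: real where "\<delta> = 1 / (real J * 2 ^ J)"
  have "1 * 1 \<le> real J * 2 ^ J" using J0 by (intro mult_mono) auto
  then have \<delta>: "0 < \<delta>" "\<delta> \<le> 1" using J0 by (auto simp: \<delta>_def)
  have "real (least_cover p n) \<le> 5 * real p powr (1 - \<delta>)"
    if p: "prime p" "2 ^ J \<le> p" and n: "0 < n" "n dvd p - 1" "real p powr \<epsilon> < real n" for p n :: nat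
  proof -
    have p1: "1 < real p" using prime_gt_1_nat[OF p(1)] by simp
    define z where "z = real p powr (1 / real J)"
    define \<tau> where "\<tau> = real p powr (- \<delta>)"
    have zpow: "z ^ m = real p powr (real m / real J)" for m
      using p1 by (simp add: z_def powr_powr flip: powr_realpow)
    have zJ: "z ^ J = real p" using zpow[of J] J0 p1 by simp
    \<comment> \<open>The threshold 2^J for p is what makes z at least 2.\<close>
    have "2 ^ J \<le> z ^ J" using p(2) zJ by (metis of_nat_le_iff of_nat_numeral of_nat_power)
    then have z2: "2 \<le> z" using J0 by (simp add: power_mono_iff z_def)
    have "\<tau> ^ (2 ^ J) = real p powr (- (\<delta> * 2 ^ J))"
      using p1 by (simp add: \<tau>_def powr_powr flip: powr_realpow)
    also have "\<delta> * 2 ^ J = 1 / real J" by (simp add: \<delta>_def)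
    finally have \<tau>J: "1 / z \<le> \<tau> ^ (2 ^ J)" by (simp add: z_def powr_minus_divide)
    have "z ^ N \<le> real p powr \<epsilon>" unfolding zpow using NJ p1 by (intro powr_mono) auto
    then have nz: "z ^ N \<le> real n" using n(3) by simp
    have ni: "real p < (real n / z ^ 4) ^ (2 ^ i)"
    proof -
      have "real p powr (\<epsilon> / 2) * z ^ 4 \<le> real p powr (\<epsilon> / 2) * real p powr (\<epsilon> / 2)"
        unfolding zpow using four p1 by (intro mult_left_mono powr_mono) auto
      also have "\<dots> = real p powr \<epsilon>" by (simp flip: powr_add)
      finally have "real p powr (\<epsilon> / 2) * z ^ 4 \<le> real n" using n(3) by simp
      then have "real p powr (\<epsilon> / 2) \<le> real n / z ^ 4" using z2 by (simp add: field_simps)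
      then have "(real p powr (\<epsilon> / 2)) ^ (2 ^ i) \<le> (real n / z ^ 4) ^ (2 ^ i)" by (intro power_mono) auto
      moreover have "(real p powr (\<epsilon> / 2)) ^ (2 ^ i) = real p powr (\<epsilon> / 2 * 2 ^ i)"
        using p1 by (simp add: powr_powr flip: powr_realpow)
      moreover have "real p powr 1 < real p powr (\<epsilon> / 2 * 2 ^ i)"
        using i \<epsilon> p1 by (intro powr_less_mono) (auto simp: field_simps)
      ultimately show ?thesis using p1 by simp
    qed
    have cov: "0 < p \<and> covers_power_residues p n p" using covers_power_residues_self[OF p(1) n(1)] .
    then have lc: "0 < least_cover p n \<and> covers_power_residues p n (least_cover p n)"
      unfolding least_cover_def by (rule LeastI)
    have lep: "least_cover p n \<le> p" unfolding least_cover_def using cov by (rule Least_le)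
    define k where "k = least_cover p n - 1"
    have "real k \<le> 4 * \<tau> * real p"
    \<comment> \<open>For k = 0 minimality gives no information, since only positive k compete; the
      bound is then trivial.\<close>
    proof (cases "k = 0")
      case False
      have "k < least_cover p n" using lc by (simp add: k_def)
      then have "\<not> (0 < k \<and> covers_power_residues p n k)" unfolding least_cover_def by (rule not_less_Least)
      then have "\<not> covers_power_residues p n k" using False by simp
      moreover have "k < p" using \<open>k < least_cover p n\<close> lep by simp
      ultimately show ?thesis
        using not_covers_bound[OF p(1) n(1,2) z2 J0 zJ _ \<tau>J, of i k] nz ni p1 by (simp add: N_def \<tau>_def)
    qed (simp add: \<tau>_def)
    also have "4 * \<tau> * real p = 4 * real p powr (1 - \<delta>)"
      using p1 by (simp add: \<tau>_def powr_diff powr_minus_divide)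
    finally have "real k \<le> 4 * real p powr (1 - \<delta>)" .
    moreover have "1 \<le> real p powr (1 - \<delta>)" using p1 \<delta> by (intro ge_one_powr_ge_zero) auto
    moreover have "real (least_cover p n) = real k + 1" using lc by (simp add: k_def of_nat_diff)
    ultimately show ?thesis by linarith
  qed
  then show ?thesis using \<delta> by blast
qed

theorem mainTheorem1:
  shows "\<exists>\<epsilon>\<^sub>0::real. \<epsilon>\<^sub>0 > 0 \<and>
    (\<forall>\<epsilon>::real. 0 < \<epsilon> \<and> \<epsilon> < \<epsilon>\<^sub>0 \<longrightarrow>
      (\<exists>\<delta>::real. \<delta> > 0 \<and> (\<exists>C::real. C > 0 \<and> (\<exists>P::nat.
        \<forall>p n :: nat. prime p \<and> p \<ge> P \<and> n > 0 \<and> odd n \<and> n dvd p - 1 \<and>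
            real n > real p powr \<epsilon> \<longrightarrow>
          real (least_cover p n) \<le> C * real p powr (1 - \<delta>)))))"
proof (rule exI[of _ 1], rule conjI, simp, rule allI, rule impI)
  fix \<epsilon> :: real assume "0 < \<epsilon> \<and> \<epsilon> < 1"
  then obtain \<delta> :: real and P :: nat where \<delta>: "0 < \<delta>" and P: "\<forall>p n::nat. prime p \<and> P \<le> p \<and> 0 < n \<and> n dvd p - 1 \<and>
      real p powr \<epsilon> < real n \<longrightarrow> real (least_cover p n) \<le> 5 * real p powr (1 - \<delta>)"
    using least_cover_bound[of \<epsilon>] by blast
  show "\<exists>\<delta>::real. \<delta> > 0 \<and> (\<exists>C::real. C > 0 \<and> (\<exists>P::nat.
        \<forall>p n :: nat. prime p \<and> p \<ge> P \<and> n > 0 \<and> odd n \<and> n dvd p - 1 \<and>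
            real n > real p powr \<epsilon> \<longrightarrow>
          real (least_cover p n) \<le> C * real p powr (1 - \<delta>)))"
    by (intro exI[of _ \<delta>] conjI \<delta> exI[of _ "5::real"] exI[of _ P]) (use P in auto)
qed

end
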